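(* For every ordinal $\alpha$ with $0\le\alpha<\omega_1$ there exist a completely regular space $X$ and a subspace $E\subseteq X$ such that $E$ is $(\alpha+1)$-embedded in $X$ and $E$ is not $\alpha$-embedded in $X$.
   Context: Completely regular spaces are understood to be Hausdorff (Tychonoff spaces). A subset $A$ of a topological space $X$ is functionally closed (functionally open) in $X$ if there is a bounded continuous function $f:X\to\mathbb R$ with $A=f^{-1}(0)$ (respectively $A=X\setminus f^{-1}(0)$). Let $\mathcal G_0^*$ (respectively $\mathcal F_0^*$) be the system of all functionally open (respectively functionally closed) subsets of $X$. For $0<\alpha<\omega_1$, assuming $\mathcal G_\xi^*$ and $\mathcal F_\xi^*$ are defined for all $\xi<\alpha$: if $\alpha$ is odd, $\mathcal G_\alpha^*$ consists of all countable intersections of sets from $\bigcup_{\xi<\alpha}\mathcal G_\xi^*$ and $\mathcal F_\alpha^*$ of all countable unions of sets from $\bigcup_{\xi<\alpha}\mathcal F_\xi^*$; if $\alpha$ is even, $\mathcal G_\alpha^*$ consists of all countable unions of sets from $\bigcup_{\xi<\alpha}\mathcal G_\xi^*$ and $\mathcal F_\alpha^*$ of all countable intersections of sets from $\bigcup_{\xi<\alpha}\mathcal F_\xi^*$ (limit ordinals are even). A set is of the functionally multiplicative class $\alpha$ in $X$ if it belongs to $\mathcal F_\alpha^*$ when $\alpha$ is even, and to $\mathcal G_\alpha^*$ when $\alpha$ is odd. A subset $A\subseteq X$ is $\alpha$-embedded in $X$ if for every set $B\subseteq A$ of the functionally multiplicative class $\alpha$ in $A$ (with the subspace topology) there is a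 set $C$ of the functionally multiplicative class $\alpha$ in $X$ with $C\cap A=B$. *)

theory Defs
  imports "HOL-Analysis.Analysis"
begin

text \<open>
  The ordinals below \<open>\<omega>\<^sub>1\<close>: the elements of the well-order \<open>cardSuc natLeq\<close>, i.e. of the least
  uncountable ordinal. An element stands for the order type of its set of predecessors.
  The lemmas \<open>countable_lessThan_omega1\<close> and \<open>uncountable_omega1\<close> below characterise the type
  as the well-order of type \<open>\<omega>\<^sub>1\<close>.
\<close>

lemma infinite_cardSuc_natLeq: "infinite (Field (cardSuc natLeq))"
  unfolding cardSuc_finite[OF natLeq_Card_order] Field_natLeq by simp

typedef omega1 = "Field (cardSuc natLeq)"
  using infinite_cardSuc_natLeq by (metis finite.emptyI ex_in_conv)

lemma Well_order_cardSuc_natLeq: "Well_order (cardSuc natLeq)"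
  using cardSuc_Card_order[OF natLeq_Card_order] card_order_on_well_order_on by blast

instantiation omega1 :: wellorder
begin

definition less_eq_omega1 :: "omega1 \<Rightarrow> omega1 \<Rightarrow> bool" where
  "less_eq_omega1 a b \<longleftrightarrow> (Rep_omega1 a, Rep_omega1 b) \<in> cardSuc natLeq"

definition less_omega1 :: "omega1 \<Rightarrow> omega1 \<Rightarrow> bool" where
  "less_omega1 a b \<longleftrightarrow> a \<le> b \<and> a \<noteq> b"

instance
proof
  let ?r = "cardSuc natLeq"
  have wo: "Refl ?r" "trans ?r" "antisym ?r" "Total ?r" "wf (?r - Id)"
    using Well_order_cardSuc_natLeq
    unfolding well_order_on_def linear_order_on_def partial_order_on_def preorder_on_def by auto
  show refl: "x \<le> x" for x :: omega1
    using wo(1) Rep_omega1[of x] unfolding less_eq_omega1_def refl_on_def by blast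
  show trans: "x \<le> z" if "x \<le> y" "y \<le> z" for x y z :: omega1
    using wo(2) that unfolding less_eq_omega1_def trans_def by blast
  show antisym: "x = y" if "x \<le> y" "y \<le> x" for x y :: omega1
    using wo(3) that unfolding less_eq_omega1_def antisym_def by (meson Rep_omega1_inject)
  show "x < y \<longleftrightarrow> x \<le> y \<and> \<not> y \<le> x" for x y :: omega1
    using antisym refl unfolding less_omega1_def by blast
  show "x \<le> y \<or> y \<le> x" for x y :: omega1
    using wo(4) Rep_omega1[of x] Rep_omega1[of y] refl[of x] Rep_omega1_inject[of x y]
    unfolding less_eq_omega1_def total_on_def by metis
  show "P a" if step: "\<And>x. (\<And>y. y < x \<Longrightarrow> P y) \<Longrightarrow> P x" for P and a :: omega1
  proof -
    have "wf (inv_image (?r - Id) Rep_omega1)"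
      using wo(5) by (rule wf_inv_image)
    then show ?thesis
    proof (induction a rule: wf_induct_rule)
      case (less x)
      show ?case
        by (rule step, rule less)
          (auto simp: inv_image_def less_omega1_def less_eq_omega1_def Rep_omega1_inject)
    qed
  qed
qed

end

instantiation omega1 :: zero
begin

definition zero_omega1 :: omega1 where
  "zero_omega1 = (LEAST a. True)"

instance ..

end

lemma zero_le_omega1: "0 \<le> (a :: omega1)"
  unfolding zero_omega1_def by (rule Least_le) simp

definition succ :: "omega1 \<Rightarrow> omega1" where
  "succ a = (LEAST b. a < b)"

lemma ex_greater_omega1: "\<exists>b. (a :: omega1) < b"
proof -
  obtain y where "y \<in> Field (cardSuc natLeq)" "Rep_omega1 a \<noteq> y"
      "(Rep_omega1 a, y) \<in> cardSuc natLeq"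
    using infinite_Card_order_limit[OF cardSuc_Card_order[OF natLeq_Card_order]
      infinite_cardSuc_natLeq Rep_omega1[of a]]
    by (metis FieldI2)
  then have "a < Abs_omega1 y"
    by (auto simp: less_omega1_def less_eq_omega1_def Abs_omega1_inverse)
  then show ?thesis ..
qed

lemma less_succ: "a < succ a"
  unfolding succ_def using LeastI_ex[OF ex_greater_omega1] .

lemma succ_le: "a < b \<Longrightarrow> succ a \<le> b"
  unfolding succ_def by (rule Least_le)

lemma countable_iff_ordLeq_natLeq: "countable A \<longleftrightarrow> (card_of A, natLeq) \<in> ordLeq"
proof -
  have "countable A \<longleftrightarrow> (\<exists>f. inj_on f A \<and> f ` A \<subseteq> (UNIV :: nat set))"
    unfolding countable_def by simp
  also have "\<dots> \<longleftrightarrow> (card_of A, card_of (UNIV :: nat set)) \<in> ordLeq"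
    by (rule card_of_ordLeq)
  also have "\<dots> \<longleftrightarrow> (card_of A, natLeq) \<in> ordLeq"
    using card_of_nat ordIso_symmetric ordLeq_ordIso_trans by blast
  finally show ?thesis .
qed

lemma countable_lessThan_omega1: "countable {..<a :: omega1}"
proof -
  let ?r = "cardSuc natLeq"
  have "(card_of (underS ?r (Rep_omega1 a)), ?r) \<in> ordLess"
    using card_of_underS[OF cardSuc_Card_order[OF natLeq_Card_order] Rep_omega1] .
  then have "countable (underS ?r (Rep_omega1 a))"
    unfolding countable_iff_ordLeq_natLeq
    using cardSuc_ordLeq_ordLess[OF natLeq_Card_order card_of_Card_order] by blast
  moreover have "Rep_omega1 ` {..<a} \<subseteq> underS ?r (Rep_omega1 a)"
    by (auto simp: underS_def less_omega1_def less_eq_omega1_def Rep_omega1_inject)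
  ultimately have "countable (Rep_omega1 ` {..<a})"
    using countable_subset by blast
  then show ?thesis
    by (rule countable_image_inj_on) (auto simp: inj_on_def Rep_omega1_inject)
qed

lemma uncountable_omega1: "uncountable (UNIV :: omega1 set)"
proof
  assume "countable (UNIV :: omega1 set)"
  then have "countable (range Rep_omega1)"
    by (rule countable_image)
  moreover have "range Rep_omega1 = Field (cardSuc natLeq)"
    using type_definition.Rep_range[OF type_definition_omega1] .
  ultimately have "(card_of (Field (cardSuc natLeq)), natLeq) \<in> ordLeq"
    by (simp add: countable_iff_ordLeq_natLeq)
  then have "(cardSuc natLeq, natLeq) \<in> ordLeq"
    using card_of_Field_ordIso[OF cardSuc_Card_order[OF natLeq_Card_order]]
      ordIso_ordLeq_trans ordIso_symmetric by blast
  then show False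
    using cardSuc_greater[OF natLeq_Card_order] not_ordLess_ordLeq by blast
qed

text \<open>
  Writing an ordinal as \<open>\<lambda> + n\<close> with \<open>\<lambda>\<close> zero or a limit and \<open>n\<close> finite, it is odd iff \<open>n\<close> is odd.
  So zero and the limit ordinals, which are not successors, are even.
\<close>

function odd_ord :: "omega1 \<Rightarrow> bool" where
  "odd_ord \<alpha> \<longleftrightarrow> (\<exists>\<beta>\<in>{..<\<alpha>}. \<alpha> = succ \<beta> \<and> \<not> odd_ord \<beta>)"
  by auto
termination
  by (relation "{(x, y). x < y}") (auto intro: wf)

abbreviation even_ord :: "omega1 \<Rightarrow> bool" where
  "even_ord \<alpha> \<equiv> \<not> odd_ord \<alpha>"

declare odd_ord.simps [simp del]

definition functionally_closed :: "'a topology \<Rightarrow> 'a set \<Rightarrow> bool" where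
  "functionally_closed X A \<longleftrightarrow>
    (\<exists>f. continuous_map X euclideanreal f \<and> bounded (f ` topspace X) \<and>
         A = {x \<in> topspace X. f x = 0})"

definition functionally_open :: "'a topology \<Rightarrow> 'a set \<Rightarrow> bool" where
  "functionally_open X A \<longleftrightarrow>
    (\<exists>f. continuous_map X euclideanreal f \<and> bounded (f ` topspace X) \<and>
         A = topspace X - {x \<in> topspace X. f x = 0})"

definition countable_unions :: "'a set set \<Rightarrow> 'a set set" where
  "countable_unions \<A> = {\<Union>n. A n | A :: nat \<Rightarrow> 'a set. range A \<subseteq> \<A>}"

definition countable_intersections :: "'a set set \<Rightarrow> 'a set set" where
  "countable_intersections \<A> = {\<Inter>n. A n | A :: nat \<Rightarrow> 'a set. range A \<subseteq> \<A>}"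

text \<open>The classes \<open>\<G>\<^sup>*\<^sub>\<alpha>\<close> and \<open>\<F>\<^sup>*\<^sub>\<alpha>\<close> of a space \<open>X\<close>.\<close>

function G_class :: "'a topology \<Rightarrow> omega1 \<Rightarrow> 'a set set" where
  "G_class X \<alpha> =
    (if \<alpha> = 0 then {A. functionally_open X A}
     else if odd_ord \<alpha> then countable_intersections (\<Union>\<xi>\<in>{..<\<alpha>}. G_class X \<xi>)
     else countable_unions (\<Union>\<xi>\<in>{..<\<alpha>}. G_class X \<xi>))"
  by auto
termination
  by (relation "inv_image {(x, y). x < y} snd") (auto intro: wf)

function F_class :: "'a topology \<Rightarrow> omega1 \<Rightarrow> 'a set set" where
  "F_class X \<alpha> =
    (if \<alpha> = 0 then {A. functionally_closed X A}
     else if odd_ord \<alpha> then countable_unions (\<Union>\<xi>\<in>{..<\<alpha>}. F_class X \<xi>)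
     else countable_intersections (\<Union>\<xi>\<in>{..<\<alpha>}. F_class X \<xi>))"
  by auto
termination
  by (relation "inv_image {(x, y). x < y} snd") (auto intro: wf)

declare G_class.simps [simp del] F_class.simps [simp del]

definition functionally_multiplicative :: "omega1 \<Rightarrow> 'a topology \<Rightarrow> 'a set \<Rightarrow> bool" where
  "functionally_multiplicative \<alpha> X A \<longleftrightarrow>
    (if even_ord \<alpha> then A \<in> F_class X \<alpha> else A \<in> G_class X \<alpha>)"

definition embedded_of_class :: "omega1 \<Rightarrow> 'a topology \<Rightarrow> 'a set \<Rightarrow> bool" where
  "embedded_of_class \<alpha> X A \<longleftrightarrow>
    A \<subseteq> topspace X \<and>
    (\<forall>B. B \<subseteq> A \<and> functionally_multiplicative \<alpha> (subtopology X A) B \<longrightarrow>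
      (\<exists>C. functionally_multiplicative \<alpha> X C \<and> C \<inter> A = B))"

text \<open>
  The existence theorem quantifies over abstract topologies \<open>X :: (real \<times> real) topology\<close>. Since
  types cannot be quantified over, this fixes a stock of continuum many points; \<open>topspace X\<close> is
  an arbitrary subset of it, and its topology is unrelated to the Euclidean one.
\<close>

end

theory Submission
  imports Defs
begin

text \<open>
  The space is a plank over the Polish space \<open>K = (nat \<Rightarrow> real)\<close>, built from a set \<open>A \<subseteq> K\<close> that belongs
  to the additive class \<open>\<alpha>\<close> of \<open>K\<close> but not to the multiplicative class \<open>\<alpha>\<close>. Such an \<open>A\<close> is the
  diagonal of a universal set, as in the proof that the Borel hierarchy does not collapse.

  Glue two copies of \<open>\<omega>\<^sub>1 + 1\<close> along their last point \<open>\<infinity>\<close>. The points over \<open>x \<in> K\<close> are \<open>(x, \<infinity>)\<close> and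
  the points \<open>(x, \<gamma>)\<close> with \<open>\<gamma> < \<omega>\<^sub>1\<close>, where \<open>\<gamma>\<close> lies in the first copy if \<open>x \<in> A\<close> and in the second
  copy if \<open>x \<notin> A\<close>; the topology is that of a subspace of \<open>K\<close> times the glued space. The subspace
  \<open>E\<close> consists of the points \<open>(x, \<gamma>)\<close> with \<open>\<gamma> < \<omega>\<^sub>1\<close>. It is the disjoint union of the two open sets
  \<open>A \<times> \<omega>\<^sub>1\<close> and \<open>(K - A) \<times> \<omega>\<^sub>1\<close>, which are pulled together only at \<open>\<infinity>\<close>.

  A real continuous function on \<open>\<omega>\<^sub>1\<close> is eventually constant. As the subspaces of \<open>K\<close> are separable,
  a real continuous function on \<open>E\<close> or on \<open>X\<close> becomes constant in \<open>\<gamma>\<close> beyond one ordinal that serves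
  all \<open>x\<close>. Sets of the classes involve only countably many functions and countable sets of ordinals
  are bounded, so these sets do not depend on \<open>\<gamma>\<close> beyond some ordinal either
  (\<open>multiplicative_class_eventually_constant\<close>).

  \<open>E\<close> is not \<open>\<alpha>\<close>-embedded (\<open>not_embedded_plank\<close>): \<open>A \<times> \<omega>\<^sub>1\<close> is clopen in \<open>E\<close>. If a set \<open>C\<close> of
  multiplicative class \<open>\<alpha>\<close> in \<open>X\<close> cuts it out of \<open>E\<close>, then \<open>C\<close> does not change between large \<open>\<gamma>\<close> and
  \<open>\<infinity>\<close>, so the slice of \<open>C\<close> at \<open>\<infinity>\<close>, which is a set of multiplicative class \<open>\<alpha>\<close> in \<open>K\<close>, equals \<open>A\<close>.

  \<open>E\<close> is \<open>(\<alpha>+1)\<close>-embedded (\<open>embedded_plank\<close>): a set \<open>B\<close> of multiplicative class \<open>\<alpha>+1\<close> in \<open>E\<close> is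
  determined by countably many slices, those up to some \<open>\<gamma>0\<close>, of which the last is repeated forever.
  Every slice is the trace on \<open>A\<close> or on \<open>K - A\<close> of a set of the same class in \<open>K\<close>. The
  complement of \<open>B\<close> is thus cut out by a countable union of sets of additive class \<open>\<alpha>+1\<close> in \<open>X\<close>; the
  tail can be treated in this way because \<open>A\<close> and \<open>K - A\<close> are both of additive class \<open>\<alpha>+1\<close>.

  The parity rule in the definition of the classes is eliminated at the outset: the
  multiplicative and additive classes form a single alternating hierarchy
  (\<open>functionally_multiplicative_iff\<close>). Since the plank has at most continuum many points, a copy of
  it lives on a set of pairs of reals.
\<close>

section \<open>Countable ordinals and their parity\<close>

lemma countable_bounded_omega1:
  assumes "countable (G :: omega1 set)"
  shows "\<exists>\<gamma>. \<forall>g\<in>G. g \<le> \<gamma>"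
proof (rule ccontr)
  assume "\<not> ?thesis"
  then have "UNIV = (\<Union>g\<in>G. {..<g})"
    by (force simp: not_le)
  then show False
    using assms countable_lessThan_omega1 uncountable_omega1 by (metis countable_UN)
qed

lemma odd_ord_succ: "odd_ord (succ \<beta>) \<longleftrightarrow> even_ord \<beta>"
proof -
  have "\<beta>' = \<beta>" if "succ \<beta> = succ \<beta>'" for \<beta>'
    using that less_succ[of \<beta>] less_succ[of \<beta>'] succ_le[of \<beta> \<beta>'] succ_le[of \<beta>' \<beta>]
    by (metis leD linorder_neqE)
  then show ?thesis
    using less_succ[of \<beta>] by (subst odd_ord.simps) auto
qed

text \<open>
  Below \<open>\<alpha>\<close>, the ordinals of parity opposite to \<open>\<alpha>\<close> are cofinal. This is why taking only
  complementary classes at each stage gives the same hierarchy as taking all earlier classes.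
\<close>

lemma ex_opposite_parity:
  assumes "\<xi> < \<alpha>"
  shows "\<exists>\<xi>'. \<xi> \<le> \<xi>' \<and> \<xi>' < \<alpha> \<and> (odd_ord \<xi>' \<longleftrightarrow> even_ord \<alpha>)"
proof (cases "odd_ord \<xi> \<longleftrightarrow> even_ord \<alpha>")
  case True
  with assms show ?thesis by auto
next
  case False
  then have "succ \<xi> \<noteq> \<alpha>" using odd_ord_succ[of \<xi>] by auto
  with succ_le[OF assms] have "succ \<xi> < \<alpha>" by auto
  then show ?thesis
    using False odd_ord_succ[of \<xi>] less_succ[of \<xi>] by (intro exI[of _ "succ \<xi>"]) auto
qed

lemma not_less_zero_omega1 [simp]: "\<not> (a :: omega1) < 0"
  using zero_le_omega1[of a] by (simp add: not_less)

lemma even_ord_zero: "even_ord 0"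
  by (subst odd_ord.simps) auto

lemma zero_less_iff_omega1: "0 < (a :: omega1) \<longleftrightarrow> a \<noteq> 0"
  using zero_le_omega1[of a] by auto

section \<open>The classes as one alternating hierarchy\<close>

text \<open>
  The function can be truncated at 1 without changing its zero set, so boundedness is no restriction.
\<close>

lemma functionally_closed_iff:
  "functionally_closed X A \<longleftrightarrow>
    (\<exists>f. continuous_map X euclideanreal f \<and> A = {x \<in> topspace X. f x = 0})"
proof
  assume "\<exists>f. continuous_map X euclideanreal f \<and> A = {x \<in> topspace X. f x = 0}"
  then obtain f where f: "continuous_map X euclideanreal f" "A = {x \<in> topspace X. f x = 0}" by auto
  have "continuous_map X euclideanreal (\<lambda>x. min 1 \<bar>f x\<bar>)"
    by (intro continuous_intros f)
  moreover have "bounded ((\<lambda>x. min 1 \<bar>f x\<bar>) ` topspace X)"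
    by (auto simp: bounded_iff intro!: exI[of _ 1])
  moreover have "A = {x \<in> topspace X. min 1 \<bar>f x\<bar> = 0}"
    using f(2) by (auto simp: min_def)
  ultimately show "functionally_closed X A"
    unfolding functionally_closed_def by (intro exI[of _ "\<lambda>x. min 1 \<bar>f x\<bar>"]) blast
qed (auto simp: functionally_closed_def)

lemma functionally_open_iff:
  "functionally_open X A \<longleftrightarrow> A \<subseteq> topspace X \<and> functionally_closed X (topspace X - A)"
proof
  assume "functionally_open X A"
  then obtain f where "continuous_map X euclideanreal f" "bounded (f ` topspace X)"
      "A = topspace X - {x \<in> topspace X. f x = 0}"
    unfolding functionally_open_def by auto
  then show "A \<subseteq> topspace X \<and> functionally_closed X (topspace X - A)"
    unfolding functionally_closed_def by blast
next
  assume "A \<subseteq> topspace X \<and> functionally_closed X (topspace X - A)"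
  then show "functionally_open X A"
    unfolding functionally_closed_def functionally_open_def by (metis double_diff order_refl)
qed

text \<open>
  The functional analogues of the Borel classes \<open>\<Sigma>\<close> and \<open>\<Pi>\<close>. Complements replace the case
  distinction on parity, which makes inductions over the hierarchy uniform.
\<close>

function additive_class :: "'a topology \<Rightarrow> omega1 \<Rightarrow> 'a set set" where
  "additive_class X \<alpha> =
    (if \<alpha> = 0 then {A. functionally_open X A}
     else countable_unions (\<Union>\<xi>\<in>{..<\<alpha>}. (\<lambda>A. topspace X - A) ` additive_class X \<xi>))"
  by auto
termination
  by (relation "inv_image {(x, y). x < y} snd") (auto intro: wf)

declare additive_class.simps [simp del]

definition multiplicative_class :: "'a topology \<Rightarrow> omega1 \<Rightarrow> 'a set set" where
  "multiplicative_class X \<alpha> = (\<lambda>A. topspace X - A) ` additive_class X \<alpha>"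

lemma additive_class_0: "additive_class X 0 = {A. functionally_open X A}"
  by (simp add: additive_class.simps)

lemma additive_class_pos:
  assumes "\<alpha> \<noteq> 0"
  shows "additive_class X \<alpha> = countable_unions (\<Union>\<xi>\<in>{..<\<alpha>}. multiplicative_class X \<xi>)"
  using assms by (subst additive_class.simps) (simp add: multiplicative_class_def)

lemma additive_class_iff:
  assumes "\<alpha> \<noteq> 0"
  shows "A \<in> additive_class X \<alpha> \<longleftrightarrow>
    (\<exists>S. A = (\<Union>n::nat. S n) \<and> (\<forall>n. \<exists>\<xi><\<alpha>. S n \<in> multiplicative_class X \<xi>))"
  unfolding additive_class_pos[OF assms] countable_unions_def by (auto simp: subset_iff Bex_def)

lemma additive_class_subset: "A \<in> additive_class X \<alpha> \<Longrightarrow> A \<subseteq> topspace X"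
  by (cases "\<alpha> = 0")
    (auto simp: additive_class_0 functionally_open_iff additive_class_iff multiplicative_class_def)

lemma multiplicative_class_subset: "A \<in> multiplicative_class X \<alpha> \<Longrightarrow> A \<subseteq> topspace X"
  by (auto simp: multiplicative_class_def)

lemma multiplicative_class_iff:
  "A \<in> multiplicative_class X \<alpha> \<longleftrightarrow> A \<subseteq> topspace X \<and> topspace X - A \<in> additive_class X \<alpha>"
  unfolding multiplicative_class_def image_iff
  by (metis Diff_subset additive_class_subset double_diff order_refl)

lemma additive_class_iff_Diff:
  "A \<in> additive_class X \<alpha> \<longleftrightarrow> A \<subseteq> topspace X \<and> topspace X - A \<in> multiplicative_class X \<alpha>"
  unfolding multiplicative_class_iff
  by (metis Diff_subset additive_class_subset double_diff order_refl)

lemma multiplicative_class_0: "multiplicative_class X 0 = {A. functionally_closed X A}"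
proof -
  have "functionally_closed X A \<Longrightarrow> A \<subseteq> topspace X" for A
    unfolding functionally_closed_def by auto
  then show ?thesis
    by (auto simp: multiplicative_class_iff additive_class_0 functionally_open_iff double_diff)
qed

lemma multiplicative_class_pos_iff:
  assumes "\<alpha> \<noteq> 0"
  shows "A \<in> multiplicative_class X \<alpha> \<longleftrightarrow>
    (\<exists>S. A = (\<Inter>n::nat. S n) \<and> (\<forall>n. \<exists>\<xi><\<alpha>. S n \<in> additive_class X \<xi>))"
proof
  assume "A \<in> multiplicative_class X \<alpha>"
  then obtain S where S: "A \<subseteq> topspace X" "topspace X - A = (\<Union>n::nat. S n)"
      "\<forall>n. \<exists>\<xi><\<alpha>. S n \<in> multiplicative_class X \<xi>"
    by (auto simp: multiplicative_class_iff[of A] additive_class_iff[OF assms])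
  have "A = (\<Inter>n. topspace X - S n)"
    using S(1,2) by blast
  moreover have "\<exists>\<xi><\<alpha>. topspace X - S n \<in> additive_class X \<xi>" for n
    using S(3) multiplicative_class_iff by metis
  ultimately show "\<exists>S. A = (\<Inter>n::nat. S n) \<and> (\<forall>n. \<exists>\<xi><\<alpha>. S n \<in> additive_class X \<xi>)"
    by blast
next
  assume "\<exists>S. A = (\<Inter>n::nat. S n) \<and> (\<forall>n. \<exists>\<xi><\<alpha>. S n \<in> additive_class X \<xi>)"
  then obtain S where S: "A = (\<Inter>n::nat. S n)" "\<And>n. \<exists>\<xi><\<alpha>. S n \<in> additive_class X \<xi>" by blast
  have "A \<subseteq> topspace X" using S additive_class_subset by blast
  moreover have "topspace X - A = (\<Union>n. topspace X - S n)" using S(1) by blast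
  moreover have "\<exists>\<xi><\<alpha>. topspace X - S n \<in> multiplicative_class X \<xi>" for n
    using S(2) additive_class_iff_Diff by metis
  ultimately show "A \<in> multiplicative_class X \<alpha>"
    unfolding multiplicative_class_iff additive_class_iff[OF assms] by blast
qed

text \<open>
  A nonzero value has modulus at least \<open>1 / (n + 1)\<close> for some \<open>n\<close>.
\<close>

lemma functionally_open_is_union_of_closed:
  assumes "functionally_open X A"
  shows "\<exists>S. A = (\<Union>n::nat. S n) \<and> (\<forall>n. functionally_closed X (S n))"
proof -
  obtain f where f: "continuous_map X euclideanreal f" "A = topspace X - {x \<in> topspace X. f x = 0}"
    using assms unfolding functionally_open_def by auto
  define S where "S n = {x \<in> topspace X. max 0 (inverse (real (Suc n)) - \<bar>f x\<bar>) = 0}" for n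
  have "functionally_closed X (S n)" for n
    unfolding functionally_closed_iff S_def
    by (intro exI[of _ "\<lambda>x. max 0 (inverse (real (Suc n)) - \<bar>f x\<bar>)"] conjI continuous_intros f) simp
  moreover have "A = (\<Union>n. S n)"
  proof -
    have "(\<exists>n. inverse (real (Suc n)) \<le> \<bar>f x\<bar>) \<longleftrightarrow> f x \<noteq> 0" for x
    proof
      assume "\<exists>n. inverse (real (Suc n)) \<le> \<bar>f x\<bar>"
      then obtain n where "inverse (real (Suc n)) \<le> \<bar>f x\<bar>" ..
      moreover have "0 < inverse (real (Suc n))" by simp
      ultimately show "f x \<noteq> 0" by linarith
    next
      assume "f x \<noteq> 0"
      then show "\<exists>n. inverse (real (Suc n)) \<le> \<bar>f x\<bar>"
        using reals_Archimedean[of "\<bar>f x\<bar>"] by (auto intro: less_imp_le)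
    qed
    moreover have "x \<in> S n \<longleftrightarrow> x \<in> topspace X \<and> inverse (real (Suc n)) \<le> \<bar>f x\<bar>" for x n
      unfolding S_def by (auto simp: max_def)
    ultimately show ?thesis
      using f(2) by auto
  qed
  ultimately show ?thesis by blast
qed

lemma multiplicative_subset_additive:
  assumes "\<xi> < \<eta>" shows "multiplicative_class X \<xi> \<subseteq> additive_class X \<eta>"
proof
  fix A assume "A \<in> multiplicative_class X \<xi>"
  moreover have "\<eta> \<noteq> 0" using assms by auto
  ultimately show "A \<in> additive_class X \<eta>"
    using assms by (auto simp: additive_class_iff intro!: exI[of _ "\<lambda>_. A"])
qed

lemma additive_class_mono:
  assumes "\<xi> \<le> \<eta>" shows "additive_class X \<xi> \<subseteq> additive_class X \<eta>"
proof (cases "\<xi> = \<eta>")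
  case False
  with assms have \<eta>: "\<xi> < \<eta>" by simp
  then have \<eta>0: "\<eta> \<noteq> 0" by auto
  show ?thesis
  proof (cases "\<xi> = 0")
    case True
    show ?thesis
    proof
      fix A assume "A \<in> additive_class X \<xi>"
      then obtain S where "A = (\<Union>n::nat. S n)" "\<And>n. S n \<in> multiplicative_class X 0"
        using functionally_open_is_union_of_closed[of X A] True
        by (auto simp: additive_class_0 multiplicative_class_0)
      moreover have "0 < \<eta>" using \<eta> True by simp
      ultimately show "A \<in> additive_class X \<eta>"
        unfolding additive_class_iff[OF \<eta>0] by blast
    qed
  next
    case False
    show ?thesis
    proof
      fix A assume "A \<in> additive_class X \<xi>"
      then obtain S where "A = (\<Union>n::nat. S n)" "\<And>n. \<exists>\<zeta><\<xi>. S n \<in> multiplicative_class X \<zeta>"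
        unfolding additive_class_iff[OF False] by blast
      moreover from this(2) \<eta> have "\<exists>\<zeta><\<eta>. S n \<in> multiplicative_class X \<zeta>" for n
        by (meson less_trans)
      ultimately show "A \<in> additive_class X \<eta>"
        unfolding additive_class_iff[OF \<eta>0] by blast
    qed
  qed
qed simp

lemma multiplicative_class_mono:
  "\<xi> \<le> \<eta> \<Longrightarrow> multiplicative_class X \<xi> \<subseteq> multiplicative_class X \<eta>"
  unfolding multiplicative_class_def by (intro image_mono additive_class_mono)

lemma additive_subset_multiplicative:
  "\<xi> < \<eta> \<Longrightarrow> additive_class X \<xi> \<subseteq> multiplicative_class X \<eta>"
  using multiplicative_subset_additive[of \<xi> \<eta> X]
  unfolding additive_class_iff_Diff[of _ X \<xi>] multiplicative_class_iff[of _ X \<eta>] subset_iff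
  by simp

lemma multiplicative_class_pos:
  assumes "\<alpha> \<noteq> 0"
  shows "multiplicative_class X \<alpha> = countable_intersections (\<Union>\<xi>\<in>{..<\<alpha>}. additive_class X \<xi>)"
proof (rule set_eqI)
  fix A
  show "A \<in> multiplicative_class X \<alpha> \<longleftrightarrow> A \<in> countable_intersections (\<Union>\<xi>\<in>{..<\<alpha>}. additive_class X \<xi>)"
    unfolding multiplicative_class_pos_iff[OF assms] countable_intersections_def
    by (simp add: image_subset_iff Bex_def)
qed

text \<open>
  At stage \<open>\<alpha>\<close> the definition of the two families collects all earlier members of the same family. By
  induction those at stages of parity opposite to \<open>\<alpha>\<close> are exactly the members of the complementary
  class, and by cofinality and monotonicity the other stages contribute nothing new.
\<close>

lemma F_G_class_eq:
  "F_class X \<alpha> = (if even_ord \<alpha> then multiplicative_class X \<alpha> else additive_class X \<alpha>) \<and>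
   G_class X \<alpha> = (if even_ord \<alpha> then additive_class X \<alpha> else multiplicative_class X \<alpha>)"
proof (induction \<alpha> rule: less_induct)
  case (less \<alpha>)
  note IH = less.IH[THEN conjunct1] less.IH[THEN conjunct2]
  show ?case
  proof (cases "\<alpha> = 0")
    case True
    then show ?thesis
      using even_ord_zero
      by (simp add: F_class.simps[of X 0] G_class.simps[of X 0] additive_class_0 multiplicative_class_0)
  next
    case False
    have FG_mono: "F_class X \<xi> \<subseteq> F_class X \<xi>' \<and> G_class X \<xi> \<subseteq> G_class X \<xi>'"
      if le: "\<xi> < \<alpha>" "\<xi>' < \<alpha>" "\<xi> \<le> \<xi>'" for \<xi> \<xi>'
    proof (cases "\<xi> = \<xi>'")
      case False
      with le(3) have "\<xi> < \<xi>'" by simp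
      note incl = additive_class_mono[OF le(3), of X] multiplicative_class_mono[OF le(3), of X]
        additive_subset_multiplicative[OF this, of X] multiplicative_subset_additive[OF this, of X]
      show ?thesis
        unfolding less[OF le(1), THEN conjunct1] less[OF le(1), THEN conjunct2]
          less[OF le(2), THEN conjunct1] less[OF le(2), THEN conjunct2]
        using incl by simp
    qed simp
    have F_mono: "F_class X \<xi> \<subseteq> F_class X \<xi>'" and G_mono: "G_class X \<xi> \<subseteq> G_class X \<xi>'"
      if "\<xi> < \<alpha>" "\<xi>' < \<alpha>" "\<xi> \<le> \<xi>'" for \<xi> \<xi>'
      using FG_mono[OF that] by simp_all
    note mult = multiplicative_class_pos[OF False, of X]
    have union_eq: "(\<Union>\<xi>\<in>{..<\<alpha>}. P \<xi>) = (\<Union>\<xi>\<in>{..<\<alpha>}. Q \<xi>)"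
      if PP: "\<And>\<xi> \<xi>'. \<xi> < \<alpha> \<Longrightarrow> \<xi>' < \<alpha> \<Longrightarrow> \<xi> \<le> \<xi>' \<Longrightarrow> P \<xi> \<subseteq> P \<xi>'"
        and QQ: "\<And>\<xi> \<xi>'. \<xi> \<le> \<xi>' \<Longrightarrow> Q \<xi> \<subseteq> Q \<xi>'"
        and PQ: "\<And>\<xi>. \<xi> < \<alpha> \<Longrightarrow> (odd_ord \<xi> \<longleftrightarrow> even_ord \<alpha>) \<Longrightarrow> P \<xi> = Q \<xi>"
      for P Q :: "omega1 \<Rightarrow> 'a set set"
    proof -
      have "\<exists>\<xi>'\<in>{..<\<alpha>}. P \<xi> \<subseteq> Q \<xi>'" "\<exists>\<xi>'\<in>{..<\<alpha>}. Q \<xi> \<subseteq> P \<xi>'" if \<xi>: "\<xi> \<in> {..<\<alpha>}" for \<xi>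
      proof -
        obtain \<xi>' where \<xi>': "\<xi> \<le> \<xi>'" "\<xi>' < \<alpha>" "odd_ord \<xi>' \<longleftrightarrow> even_ord \<alpha>"
          using ex_opposite_parity[of \<xi> \<alpha>] \<xi> by auto
        then have "P \<xi> \<subseteq> Q \<xi>'" "Q \<xi> \<subseteq> P \<xi>'"
          using PP[of \<xi> \<xi>'] QQ[of \<xi> \<xi>'] PQ[of \<xi>'] \<xi> by auto
        with \<xi>'(2) show "\<exists>\<xi>'\<in>{..<\<alpha>}. P \<xi> \<subseteq> Q \<xi>'" "\<exists>\<xi>'\<in>{..<\<alpha>}. Q \<xi> \<subseteq> P \<xi>'"
          by auto
      qed
      then show ?thesis
        by (meson SUP_mono subset_antisym)
    qed
    show ?thesis
    proof (cases "odd_ord \<alpha>")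
      case True
      have "(\<Union>\<xi>\<in>{..<\<alpha>}. F_class X \<xi>) = (\<Union>\<xi>\<in>{..<\<alpha>}. multiplicative_class X \<xi>)"
          "(\<Union>\<xi>\<in>{..<\<alpha>}. G_class X \<xi>) = (\<Union>\<xi>\<in>{..<\<alpha>}. additive_class X \<xi>)"
        by (rule union_eq[of "F_class X" "multiplicative_class X", OF F_mono multiplicative_class_mono]; simp add: IH True)
          (rule union_eq[of "G_class X" "additive_class X", OF G_mono additive_class_mono]; simp add: IH True)
      then show ?thesis
        using True False mult
        by (simp add: F_class.simps[of X \<alpha>] G_class.simps[of X \<alpha>] additive_class_pos)
    next
      case even: False
      have "(\<Union>\<xi>\<in>{..<\<alpha>}. F_class X \<xi>) = (\<Union>\<xi>\<in>{..<\<alpha>}. additive_class X \<xi>)"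
          "(\<Union>\<xi>\<in>{..<\<alpha>}. G_class X \<xi>) = (\<Union>\<xi>\<in>{..<\<alpha>}. multiplicative_class X \<xi>)"
        by (rule union_eq[of "F_class X" "additive_class X", OF F_mono additive_class_mono]; simp add: IH even)
          (rule union_eq[of "G_class X" "multiplicative_class X", OF G_mono multiplicative_class_mono]; simp add: IH even)
      then show ?thesis
        using even False mult
        by (simp add: F_class.simps[of X \<alpha>] G_class.simps[of X \<alpha>] additive_class_pos)
    qed
  qed
qed

lemma functionally_multiplicative_iff:
  "functionally_multiplicative \<alpha> X A \<longleftrightarrow> A \<in> multiplicative_class X \<alpha>"
  using F_G_class_eq[of X \<alpha>] by (auto simp: functionally_multiplicative_def)

section \<open>Closure properties of the classes\<close>

lemma functionally_closed_preimage:
  assumes h: "continuous_map X Y h" and S: "functionally_closed Y S"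
  shows "functionally_closed X {x \<in> topspace X. h x \<in> S}"
proof -
  obtain f where f: "continuous_map Y euclideanreal f" "S = {y \<in> topspace Y. f y = 0}"
    using S unfolding functionally_closed_iff by auto
  have "{x \<in> topspace X. h x \<in> S} = {x \<in> topspace X. (f \<circ> h) x = 0}"
    using continuous_map_image_subset_topspace[OF h] f(2) by auto
  with continuous_map_compose[OF h f(1)] show ?thesis
    unfolding functionally_closed_iff by blast
qed

lemma preimage_Diff_topspace:
  assumes "continuous_map X Y h"
  shows "{x \<in> topspace X. h x \<in> topspace Y - S} = topspace X - {x \<in> topspace X. h x \<in> S}"
  using continuous_map_image_subset_topspace[OF assms] by auto

lemma additive_class_preimage:
  assumes h: "continuous_map X Y h"
  shows "S \<in> additive_class Y \<alpha> \<Longrightarrow> {x \<in> topspace X. h x \<in> S} \<in> additive_class X \<alpha>"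
proof (induction \<alpha> arbitrary: S rule: less_induct)
  case (less \<alpha>)
  show ?case
  proof (cases "\<alpha> = 0")
    case True
    with less.prems show ?thesis
      using functionally_closed_preimage[OF h, of "topspace Y - S"]
      unfolding preimage_Diff_topspace[OF h] by (auto simp: additive_class_0 functionally_open_iff)
  next
    case False
    then obtain T where T: "S = (\<Union>n::nat. T n)" "\<And>n. \<exists>\<xi><\<alpha>. T n \<in> multiplicative_class Y \<xi>"
      using less.prems by (auto simp: additive_class_iff)
    have "\<exists>\<xi><\<alpha>. {x \<in> topspace X. h x \<in> T n} \<in> multiplicative_class X \<xi>" for n
    proof -
      obtain \<xi> where \<xi>: "\<xi> < \<alpha>" "T n \<in> multiplicative_class Y \<xi>" using T(2) by blast
      then have "topspace Y - T n \<in> additive_class Y \<xi>"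
        by (simp add: multiplicative_class_iff)
      from less.IH[OF \<xi>(1) this] show ?thesis
        using \<xi>(1) unfolding preimage_Diff_topspace[OF h] multiplicative_class_iff by blast
    qed
    moreover have "{x \<in> topspace X. h x \<in> S} = (\<Union>n. {x \<in> topspace X. h x \<in> T n})"
      using T(1) by blast
    ultimately show ?thesis
      unfolding additive_class_iff[OF False]
      by (intro exI[of _ "\<lambda>n. {x \<in> topspace X. h x \<in> T n}"]) blast
  qed
qed

lemma multiplicative_class_preimage:
  assumes h: "continuous_map X Y h" and "S \<in> multiplicative_class Y \<alpha>"
  shows "{x \<in> topspace X. h x \<in> S} \<in> multiplicative_class X \<alpha>"
  using additive_class_preimage[OF h, of "topspace Y - S" \<alpha>] assms(2)
  unfolding preimage_Diff_topspace[OF h] multiplicative_class_iff by blast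

lemma functionally_closed_euclidean_iff:
  fixes S :: "'a :: metric_space set"
  shows "functionally_closed (euclidean :: 'a topology) S \<longleftrightarrow> closed S"
proof
  assume "closed S"
  show "functionally_closed euclidean S"
  proof (cases "S = {}")
    case True
    then show ?thesis
      unfolding functionally_closed_iff by (intro exI[of _ "\<lambda>_. 1"]) simp
  next
    case False
    have "continuous_map euclidean euclideanreal (\<lambda>x. infdist x S)"
      by (simp add: continuous_on_infdist)
    moreover have "S = {x \<in> topspace euclidean. infdist x S = 0}"
      using in_closed_iff_infdist_zero[OF \<open>closed S\<close> False] by auto
    ultimately show ?thesis
      unfolding functionally_closed_iff by blast
  qed
next
  assume "functionally_closed euclidean S"
  then obtain f where "continuous_on UNIV f" "S = {x. f x = (0::real)}"
    unfolding functionally_closed_iff by auto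
  then show "closed S"
    using continuous_closed_vimage[of "{0}" f]
    by (simp add: vimage_def continuous_on_eq_continuous_at)
qed

lemma functionally_open_euclidean_iff:
  fixes S :: "'a :: metric_space set"
  shows "functionally_open (euclidean :: 'a topology) S \<longleftrightarrow> open S"
  by (simp add: functionally_open_iff functionally_closed_euclidean_iff open_closed Compl_eq_Diff_UNIV)

text \<open>
  Countably many functions form one continuous map into the metrizable space \<open>nat \<Rightarrow> real\<close>, and
  the intersection of their zero sets is the preimage of the closed set \<open>{0}\<close>.
\<close>

lemma functionally_closed_Inter:
  assumes "\<And>n::nat. functionally_closed X (S n)"
  shows "functionally_closed X (\<Inter>n. S n)"
proof -
  obtain f where f: "\<And>n. continuous_map X euclideanreal (f n)" "\<And>n. S n = {x \<in> topspace X. f n x = 0}"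
    using assms unfolding functionally_closed_iff by metis
  have "continuous_map X (product_topology (\<lambda>_. euclideanreal) UNIV) (\<lambda>x n. f n x)"
    using f(1) by (simp add: continuous_map_componentwise_UNIV)
  then have "continuous_map X (euclidean :: (nat \<Rightarrow> real) topology) (\<lambda>x n. f n x)"
    by (simp add: euclidean_product_topology)
  moreover have "functionally_closed euclidean {\<lambda>n::nat. 0::real}"
    by (simp add: functionally_closed_euclidean_iff)
  ultimately have "functionally_closed X {x \<in> topspace X. (\<lambda>n. f n x) \<in> {\<lambda>n::nat. 0}}"
    by (rule functionally_closed_preimage)
  also have "{x \<in> topspace X. (\<lambda>n. f n x) \<in> {\<lambda>n::nat. 0}} = (\<Inter>n. S n)"
    using f(2) by (auto simp: fun_eq_iff)
  finally show ?thesis .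
qed

lemma multiplicative_class_Inter:
  assumes "\<And>n::nat. S n \<in> multiplicative_class X \<alpha>"
  shows "(\<Inter>n. S n) \<in> multiplicative_class X \<alpha>"
proof (cases "\<alpha> = 0")
  case True
  then show ?thesis
    using functionally_closed_Inter[of X S] assms by (simp add: multiplicative_class_0)
next
  case False
  then obtain T where T: "\<And>n. S n = (\<Inter>m::nat. T n m)" "\<And>n m. \<exists>\<xi><\<alpha>. T n m \<in> additive_class X \<xi>"
    using assms unfolding multiplicative_class_pos_iff[OF False] by metis
  define U where "U k = T (fst (prod_decode k)) (snd (prod_decode k))" for k
  have "(\<Inter>n. S n) = (\<Inter>k. U k)"
  proof (intro subset_antisym INT_greatest)
    show "(\<Inter>n. S n) \<subseteq> U k" for k
      unfolding T(1) U_def by blast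
    have "(\<Inter>k. U k) \<subseteq> T n m" for n m
    proof -
      have "(\<Inter>k. U k) \<subseteq> U (prod_encode (n, m))" by blast
      then show ?thesis by (simp add: U_def)
    qed
    then show "(\<Inter>k. U k) \<subseteq> S n" for n
      unfolding T(1) by (intro INT_greatest)
  qed
  moreover have "\<exists>\<xi><\<alpha>. U k \<in> additive_class X \<xi>" for k
    unfolding U_def by (rule T(2))
  ultimately show ?thesis
    unfolding multiplicative_class_pos_iff[OF False] by blast
qed

lemma multiplicative_class_Int:
  assumes "S \<in> multiplicative_class X \<alpha>" "T \<in> multiplicative_class X \<alpha>"
  shows "S \<inter> T \<in> multiplicative_class X \<alpha>"
proof -
  have "S \<inter> T = (\<Inter>n::nat. if n = 0 then S else T)" by auto
  then show ?thesis
    using multiplicative_class_Inter[of "\<lambda>n::nat. if n = 0 then S else T" X \<alpha>] assms by simp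
qed

lemma additive_class_Union:
  assumes "\<And>n::nat. S n \<in> additive_class X \<alpha>"
  shows "(\<Union>n. S n) \<in> additive_class X \<alpha>"
proof -
  have "(\<Inter>n. topspace X - S n) \<in> multiplicative_class X \<alpha>"
    by (intro multiplicative_class_Inter) (use assms additive_class_iff_Diff in blast)
  moreover have "(\<Inter>n. topspace X - S n) = topspace X - (\<Union>n. S n)" by blast
  moreover have "(\<Union>n. S n) \<subseteq> topspace X" using assms additive_class_subset by blast
  ultimately show ?thesis unfolding additive_class_iff_Diff[of "\<Union>n. S n"] by simp
qed

lemma empty_in_additive_class: "{} \<in> additive_class X \<alpha>"
proof -
  have "functionally_open X {}"
    unfolding functionally_open_iff functionally_closed_iff
    by (auto intro!: exI[of _ "\<lambda>_. 0"])
  then show ?thesis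
    using additive_class_mono[OF zero_le_omega1, of X \<alpha>] by (auto simp: additive_class_0)
qed

lemma additive_class_UN:
  assumes "countable I" "\<And>i. i \<in> I \<Longrightarrow> S i \<in> additive_class X \<alpha>"
  shows "(\<Union>i\<in>I. S i) \<in> additive_class X \<alpha>"
proof (cases "I = {}")
  case False
  then have "(\<Union>i\<in>I. S i) = (\<Union>n. S (from_nat_into I n))"
    using range_from_nat_into[OF False assms(1)] by (metis UN_simps(10))
  then show ?thesis
    using additive_class_Union[of "\<lambda>n. S (from_nat_into I n)" X \<alpha>] assms(2) from_nat_into[OF False] by simp
qed (simp add: empty_in_additive_class)

lemma additive_class_Un:
  assumes "S \<in> additive_class X \<alpha>" "T \<in> additive_class X \<alpha>"
  shows "S \<union> T \<in> additive_class X \<alpha>"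
  using additive_class_UN[of "{S, T}" "\<lambda>U. U" X \<alpha>] assms by auto

text \<open>
  The sets that make up the two unions may come from different stages; monotonicity moves each pair
  into the larger one. The base class, which is not defined through unions, is left out.
\<close>

lemma additive_class_Int:
  assumes "\<alpha> \<noteq> 0" "S \<in> additive_class X \<alpha>" "T \<in> additive_class X \<alpha>"
  shows "S \<inter> T \<in> additive_class X \<alpha>"
proof -
  obtain S' where S': "S = (\<Union>n::nat. S' n)" "\<And>n. \<exists>\<xi><\<alpha>. S' n \<in> multiplicative_class X \<xi>"
    using assms(2) unfolding additive_class_iff[OF assms(1)] by blast
  obtain T' where T': "T = (\<Union>n::nat. T' n)" "\<And>n. \<exists>\<xi><\<alpha>. T' n \<in> multiplicative_class X \<xi>"
    using assms(3) unfolding additive_class_iff[OF assms(1)] by blast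
  have "S' n \<inter> T' m \<in> additive_class X \<alpha>" for n m
  proof -
    obtain \<xi> \<zeta> where *: "\<xi> < \<alpha>" "S' n \<in> multiplicative_class X \<xi>" "\<zeta> < \<alpha>" "T' m \<in> multiplicative_class X \<zeta>"
      using S'(2) T'(2) by blast
    then have "S' n \<in> multiplicative_class X (max \<xi> \<zeta>)" "T' m \<in> multiplicative_class X (max \<xi> \<zeta>)"
      using multiplicative_class_mono[of _ "max \<xi> \<zeta>" X] by (meson max.cobounded1 max.cobounded2 subsetD)+
    then have "S' n \<inter> T' m \<in> multiplicative_class X (max \<xi> \<zeta>)"
      by (rule multiplicative_class_Int)
    then show ?thesis
      using multiplicative_subset_additive[of "max \<xi> \<zeta>" \<alpha> X] * by auto
  qed
  then have "(\<Union>n. \<Union>m. S' n \<inter> T' m) \<in> additive_class X \<alpha>"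
    by (intro additive_class_Union)
  moreover have "(\<Union>n. \<Union>m. S' n \<inter> T' m) = S \<inter> T" unfolding S'(1) T'(1) by blast
  ultimately show ?thesis by simp
qed

text \<open>
  Subspaces of a metric space are \<open>\<alpha>\<close>-embedded for every \<open>\<alpha>\<close>: relatively open sets are traces of open
  sets, and taking traces commutes with complements and countable unions.
\<close>

lemma additive_class_trace:
  fixes A :: "'a :: metric_space set"
  shows "S \<in> additive_class (top_of_set A) \<alpha> \<Longrightarrow> \<exists>T \<in> additive_class euclidean \<alpha>. S = A \<inter> T"
proof (induction \<alpha> arbitrary: S rule: less_induct)
  case (less \<alpha>)
  show ?case
  proof (cases "\<alpha> = 0")
    case True
    then obtain f where f: "continuous_on A f" "S = A - {x \<in> A. f x = (0::real)}"
      using less.prems by (auto simp: additive_class_0 functionally_open_def)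
    then have "S = A \<inter> f -` (- {0})" by auto
    then have "openin (top_of_set A) S"
      using continuous_openin_preimage_gen[OF f(1), of "- {0}"] by (simp add: open_Compl)
    then obtain U where "open U" "S = A \<inter> U"
      unfolding openin_open by blast
    then show ?thesis
      unfolding True additive_class_0 Bex_def mem_Collect_eq functionally_open_euclidean_iff by blast
  next
    case False
    then obtain T where T: "S = (\<Union>n::nat. T n)" "\<And>n. \<exists>\<xi><\<alpha>. T n \<in> multiplicative_class (top_of_set A) \<xi>"
      using less.prems by (auto simp: additive_class_iff)
    have "\<exists>U. T n = A \<inter> U \<and> (\<exists>\<xi><\<alpha>. U \<in> multiplicative_class euclidean \<xi>)" for n
    proof -
      obtain \<xi> where \<xi>: "\<xi> < \<alpha>" "T n \<in> multiplicative_class (top_of_set A) \<xi>" using T(2) by blast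
      then have "T n \<subseteq> A" and "A - T n \<in> additive_class (top_of_set A) \<xi>"
        by (simp_all add: multiplicative_class_iff)
      with less.IH[OF \<xi>(1), of "A - T n"] obtain V where "V \<in> additive_class euclidean \<xi>" "A - T n = A \<inter> V"
        by blast
      moreover from this have "T n = A \<inter> (UNIV - V)"
        using \<open>T n \<subseteq> A\<close> by blast
      ultimately have "T n = A \<inter> (UNIV - V)" "UNIV - V \<in> multiplicative_class euclidean \<xi>"
        by (simp_all add: additive_class_iff_Diff[of V euclidean \<xi>])
      with \<xi>(1) show ?thesis by blast
    qed
    then obtain U where U: "\<And>n. T n = A \<inter> U n" "\<And>n. \<exists>\<xi><\<alpha>. U n \<in> multiplicative_class euclidean \<xi>"
      by metis
    have "(\<Union>n. U n) \<in> additive_class euclidean \<alpha>"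
      unfolding additive_class_iff[OF False] using U(2) by blast
    moreover have "S = A \<inter> (\<Union>n. U n)" unfolding T(1) U(1) by blast
    ultimately show ?thesis by blast
  qed
qed

lemma multiplicative_class_trace:
  fixes A :: "'a :: metric_space set"
  assumes "S \<in> multiplicative_class (top_of_set A) \<alpha>"
  shows "\<exists>T \<in> multiplicative_class euclidean \<alpha>. S = A \<inter> T"
proof -
  have "S \<subseteq> A" "A - S \<in> additive_class (top_of_set A) \<alpha>"
    using assms by (simp_all add: multiplicative_class_iff)
  with additive_class_trace[of "A - S" A \<alpha>] obtain V where
      "V \<in> additive_class euclidean \<alpha>" "A - S = A \<inter> V" by blast
  with \<open>S \<subseteq> A\<close> show ?thesis
    using additive_class_iff_Diff[of V euclidean \<alpha>]
    by (intro bexI[of _ "UNIV - V"]) auto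
qed

section \<open>The hierarchy does not collapse\<close>

text \<open>
  A sequence of reals codes a doubly indexed family of such sequences.
\<close>

definition subcode :: "nat \<Rightarrow> nat \<Rightarrow> (nat \<Rightarrow> real) \<Rightarrow> nat \<Rightarrow> real" where
  "subcode k n y = (\<lambda>m. y (prod_encode (prod_encode (k, n), m)))"

lemma continuous_on_subcode: "continuous_on UNIV (subcode k n)"
  unfolding subcode_def
  by (intro continuous_on_coordinatewise_then_product continuous_on_product_coordinates)

lemma ex_prescribed_subcodes: "\<exists>y. \<forall>k n. subcode k n y = c k n"
proof -
  define y where "y i = (let (p, m) = prod_decode i; (k, n) = prod_decode p in c k n m)" for i
  have "subcode k n y = c k n" for k n
    by (simp add: subcode_def y_def)
  then show ?thesis by blast
qed

text \<open>
  The points of \<open>nat \<Rightarrow> real\<close> serve as codes. An open set is coded by a sequence of indices of basic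
  open sets. At a later stage, let \<open>e\<close> enumerate the ordinals below \<open>\<alpha>\<close>; the subcode at \<open>(k, n)\<close> then
  codes the complement of the \<open>n\<close>-th set of a union, provided that this set is of multiplicative class
  \<open>e k\<close>, and codes the complement of the empty set otherwise. So no choice of a stage for each set
  enters into the universal set itself.
\<close>

lemma universal_additive_set:
  "\<exists>W \<in> additive_class (euclidean :: ((nat \<Rightarrow> real) \<times> (nat \<Rightarrow> real)) topology) \<alpha>.
    \<forall>S \<in> additive_class (euclidean :: (nat \<Rightarrow> real) topology) \<alpha>. \<exists>y. S = {x. (y, x) \<in> W}"
proof (induction \<alpha> rule: less_induct)
  case (less \<alpha>)
  show ?case
  proof (cases "\<alpha> = 0")
    case True
    obtain \<B> :: "(nat \<Rightarrow> real) set set" where \<B>: "countable \<B>" "topological_basis \<B>"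
      using ex_countable_basis by auto
    \<comment> \<open>The empty set is included so that superfluous indices can be filled.\<close>
    define b where "b = from_nat_into (insert {} \<B>)"
    have b: "range b = insert {} \<B>"
      unfolding b_def using \<B>(1) by (intro range_from_nat_into) auto
    have open_b: "open (b n)" for n
      using b \<B>(2) topological_basis_open[OF \<B>(2)] by (metis insertE open_empty rangeI)
    \<comment> \<open>The entry \<open>y n\<close> is read as the index \<open>k\<close> within \<open>1 / 2\<close> of it, if there is one; this keeps \<open>W\<close> open.\<close>
    define W where "W = (\<Union>n. \<Union>k. {y :: nat \<Rightarrow> real. y n \<in> ball (real k) (1 / 2)} \<times> b k)"
    have "open {y :: nat \<Rightarrow> real. y n \<in> ball (real k) (1 / 2)}" for n k
      using product_topology_basis'[of "{n}" "\<lambda>_. ball (real k) (1 / 2)" "\<lambda>i. i"] by simp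
    then have "open W"
      unfolding W_def by (intro open_UN ballI open_Times open_b)
    moreover have "\<exists>y. S = {x. (y, x) \<in> W}" if "open S" for S
    proof -
      obtain \<B>' where \<B>': "\<B>' \<subseteq> \<B>" "S = \<Union>\<B>'"
        using \<open>open S\<close> \<B>(2) unfolding topological_basis_def by metis
      have "\<exists>m. b m = (if b n \<in> \<B>' then b n else {})" for n
        using b by (metis insertI1 rangeE)
      then obtain m where m: "\<And>n. b (m n) = (if b n \<in> \<B>' then b n else {})" by metis
      define y where "y n = real (m n)" for n
      have "\<B>' \<subseteq> range b" using b \<B>'(1) by blast
      have near: "y n \<in> ball (real k) (1 / 2) \<longleftrightarrow> k = m n" for n k
      proof -
        have "real i + 1 \<le> real j" if "i < j" for i j using that by simp
        from this[of k "m n"] this[of "m n" k] show ?thesis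
          unfolding y_def by (cases k "m n" rule: linorder_cases) (auto simp: dist_real_def)
      qed
      have "{x. (y, x) \<in> W} = (\<Union>n. b (m n))" unfolding W_def by (auto simp del: mem_ball simp: near)
      also have "\<dots> = S"
      proof
        show "(\<Union>n. b (m n)) \<subseteq> S" unfolding m \<B>'(2) by auto
        show "S \<subseteq> (\<Union>n. b (m n))"
        proof
          fix x assume "x \<in> S"
          then obtain n where "x \<in> b n" "b n \<in> \<B>'" using \<B>'(2) \<open>\<B>' \<subseteq> range b\<close> by blast
          then show "x \<in> (\<Union>n. b (m n))" by (intro UN_I[of n]) (simp_all add: m)
        qed
      qed
      finally show ?thesis by (intro exI[of _ y]) (rule sym)
    qed
    ultimately show ?thesis
      unfolding True additive_class_0 functionally_open_euclidean_iff
      by (intro bexI[of _ W] ballI CollectI) (erule CollectE)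
  next
    case False
    define e where "e = from_nat_into {..<\<alpha>}"
    have "0 < \<alpha>" using False by (simp add: zero_less_iff_omega1)
    then have e: "range e = {..<\<alpha>}"
      unfolding e_def by (intro range_from_nat_into countable_lessThan_omega1) auto
    then have e_less: "e k < \<alpha>" for k by blast
    have "\<forall>k. \<exists>W. W \<in> additive_class (euclidean :: ((nat \<Rightarrow> real) \<times> (nat \<Rightarrow> real)) topology) (e k) \<and>
        (\<forall>S \<in> additive_class (euclidean :: (nat \<Rightarrow> real) topology) (e k). \<exists>y. S = {x. (y, x) \<in> W})"
      using less.IH[OF e_less] by blast
    from choice[OF this] obtain W where "\<forall>k. W k \<in> additive_class (euclidean :: ((nat \<Rightarrow> real) \<times> (nat \<Rightarrow> real)) topology) (e k) \<and>
        (\<forall>S \<in> additive_class (euclidean :: (nat \<Rightarrow> real) topology) (e k). \<exists>y. S = {x. (y, x) \<in> W k})" ..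
    then have W: "\<And>k. W k \<in> additive_class euclidean (e k)"
      "\<And>k S. S \<in> additive_class euclidean (e k) \<Longrightarrow> \<exists>y. S = {x. (y, x) \<in> W k}" by auto
    define U where "U = (\<Union>k. \<Union>n. {p. (subcode k n (fst p), snd p) \<notin> W k})"
    have "U \<in> additive_class euclidean \<alpha>"
      unfolding U_def
    proof (intro additive_class_Union)
      fix k n
      have "continuous_on UNIV (\<lambda>p :: (nat \<Rightarrow> real) \<times> (nat \<Rightarrow> real). (subcode k n (fst p), snd p))"
        by (intro continuous_on_Pair continuous_on_compose2[OF continuous_on_subcode]
            continuous_on_fst continuous_on_snd continuous_on_id subset_UNIV)
      then have "{p \<in> topspace euclidean. (subcode k n (fst p), snd p) \<in> W k} \<in> additive_class euclidean (e k)"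
        by (intro additive_class_preimage[OF _ W(1)]) simp
      then have "{p. (subcode k n (fst p), snd p) \<notin> W k} \<in> multiplicative_class euclidean (e k)"
        by (subst (asm) additive_class_iff_Diff) (simp add: set_diff_eq)
      then show "{p. (subcode k n (fst p), snd p) \<notin> W k} \<in> additive_class euclidean \<alpha>"
        using multiplicative_subset_additive[OF e_less] by blast
    qed
    moreover have "\<exists>y. S = {x. (y, x) \<in> U}" if "S \<in> additive_class euclidean \<alpha>" for S
    proof -
      obtain V where V: "S = (\<Union>n::nat. V n)" "\<And>n. \<exists>\<xi><\<alpha>. V n \<in> multiplicative_class euclidean \<xi>"
        using \<open>S \<in> _\<close> unfolding additive_class_iff[OF False] by blast
      define V' where "V' k n = (if V n \<in> multiplicative_class euclidean (e k) then V n else {})" for k n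
      have "\<exists>y. {x. (y, x) \<notin> W k} = V' k n" for k n
      proof -
        have "{} \<in> multiplicative_class (euclidean :: (nat \<Rightarrow> real) topology) (e k)"
          using multiplicative_class_mono[OF zero_le_omega1, of euclidean "e k"]
          by (auto simp: multiplicative_class_0 functionally_closed_euclidean_iff)
        then have "V' k n \<in> multiplicative_class euclidean (e k)"
          by (simp add: V'_def)
        then have "UNIV - V' k n \<in> additive_class euclidean (e k)"
          by (subst (asm) multiplicative_class_iff) simp
        from W(2)[OF this] obtain y where y: "UNIV - V' k n = {x. (y, x) \<in> W k}" ..
        have "{x. (y, x) \<notin> W k} = UNIV - (UNIV - V' k n)" unfolding y by blast
        then show ?thesis by (intro exI[of _ y]) (simp add: double_diff)
      qed
      then have "\<forall>p. \<exists>y. {x. (y, x) \<notin> W (fst p)} = V' (fst p) (snd p)" by blast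
      from choice[OF this] obtain c where
        "\<forall>p. {x. (c p, x) \<notin> W (fst p)} = V' (fst p) (snd p)" ..
      then have c: "{x. (c (k, n), x) \<notin> W k} = V' k n" for k n
        by (metis fst_conv snd_conv)
      obtain y where y: "\<And>k n. subcode k n y = c (k, n)"
        using ex_prescribed_subcodes[of "\<lambda>k n. c (k, n)"] by blast
      have "{x. (y, x) \<in> U} = (\<Union>k. \<Union>n. {x. (c (k, n), x) \<notin> W k})"
        unfolding U_def by (auto simp: y)
      also have "\<dots> = S"
      proof
        show "(\<Union>k. \<Union>n. {x. (c (k, n), x) \<notin> W k}) \<subseteq> S"
          unfolding c V'_def V(1) by (intro UN_least) auto
        show "S \<subseteq> (\<Union>k. \<Union>n. {x. (c (k, n), x) \<notin> W k})"
        proof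
          fix x assume "x \<in> S"
          then obtain n where "x \<in> V n" unfolding V(1) by blast
          obtain \<xi> where "\<xi> < \<alpha>" "V n \<in> multiplicative_class euclidean \<xi>" using V(2) by blast
          moreover then obtain k where "\<xi> = e k" using e by (metis lessThan_iff rangeE)
          ultimately have "x \<in> {x. (c (k, n), x) \<notin> W k}" unfolding c V'_def using \<open>x \<in> V n\<close> by simp
          then show "x \<in> (\<Union>k. \<Union>n. {x. (c (k, n), x) \<notin> W k})" by blast
        qed
      qed
      finally show ?thesis by (intro exI[of _ y]) (rule sym)
    qed
    ultimately show ?thesis by (intro bexI[of _ U] ballI)
  qed
qed

text \<open>
  Cantor's diagonal: if the diagonal of a universal set were of multiplicative class, its complement
  would be a section of the universal set, at a code that both does and does not belong to it.
\<close>

lemma ex_additive_not_multiplicative: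
  "\<exists>A. A \<in> additive_class (euclidean :: (nat \<Rightarrow> real) topology) \<alpha> \<and> A \<notin> multiplicative_class euclidean \<alpha>"
proof -
  from universal_additive_set[of \<alpha>] obtain W where
    W: "W \<in> additive_class (euclidean :: ((nat \<Rightarrow> real) \<times> (nat \<Rightarrow> real)) topology) \<alpha>" and
    univ: "\<forall>S \<in> additive_class (euclidean :: (nat \<Rightarrow> real) topology) \<alpha>. \<exists>y. S = {x. (y, x) \<in> W}" ..
  define A where "A = {x. (x, x) \<in> W}"
  have "continuous_on UNIV (\<lambda>x :: nat \<Rightarrow> real. (x, x))" by (intro continuous_intros)
  then have "A \<in> additive_class euclidean \<alpha>"
    using additive_class_preimage[of euclidean euclidean "\<lambda>x. (x, x)" W \<alpha>] W by (simp add: A_def)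
  moreover have "A \<notin> multiplicative_class euclidean \<alpha>"
  proof
    assume "A \<in> multiplicative_class euclidean \<alpha>"
    then have "UNIV - A \<in> additive_class euclidean \<alpha>"
      by (simp add: multiplicative_class_iff)
    from bspec[OF univ this] obtain y where y: "UNIV - A = {x. (y, x) \<in> W}" ..
    have "y \<in> UNIV - A \<longleftrightarrow> (y, y) \<in> W" unfolding y by simp
    then show False by (simp add: A_def)
  qed
  ultimately show ?thesis by blast
qed

section \<open>Transfer to pairs of reals\<close>

lemma embedded_of_class_iff:
  "embedded_of_class \<alpha> X A \<longleftrightarrow> A \<subseteq> topspace X \<and>
    (\<forall>B \<in> multiplicative_class (subtopology X A) \<alpha>. \<exists>C \<in> multiplicative_class X \<alpha>. C \<inter> A = B)"
proof -
  have "B \<subseteq> A" if "B \<in> multiplicative_class (subtopology X A) \<alpha>" for B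
    using multiplicative_class_subset[OF that] by auto
  then show ?thesis
    unfolding embedded_of_class_def functionally_multiplicative_iff Ball_def Bex_def by auto
qed

lemma embedded_of_class_homeomorphic:
  assumes hom: "homeomorphic_maps X Y f g" and E: "embedded_of_class \<alpha> X E"
  shows "embedded_of_class \<alpha> Y (f ` E)"
proof -
  have f: "continuous_map X Y f" and g: "continuous_map Y X g"
    and gf: "\<And>x. x \<in> topspace X \<Longrightarrow> g (f x) = x" and ET: "E \<subseteq> topspace X"
    using hom E unfolding homeomorphic_maps_def embedded_of_class_def by auto
  have fE: "f ` E \<subseteq> topspace Y"
    using continuous_map_image_subset_topspace[OF f] ET by auto
  have "\<exists>C \<in> multiplicative_class Y \<alpha>. C \<inter> f ` E = B"
    if B: "B \<in> multiplicative_class (subtopology Y (f ` E)) \<alpha>" for B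
  proof -
    have "continuous_map (subtopology X E) (subtopology Y (f ` E)) f"
      using f ET by (auto simp: continuous_map_in_subtopology continuous_map_from_subtopology)
    from multiplicative_class_preimage[OF this B]
    have "{x \<in> E. f x \<in> B} \<in> multiplicative_class (subtopology X E) \<alpha>"
      using ET by (simp add: Int_absorb1)
    with E obtain C where C: "C \<in> multiplicative_class X \<alpha>" "C \<inter> E = {x \<in> E. f x \<in> B}"
      unfolding embedded_of_class_iff by metis
    have "{y \<in> topspace Y. g y \<in> C} \<inter> f ` E = B"
    proof -
      have "f x \<in> B \<longleftrightarrow> x \<in> C" if "x \<in> E" for x using C(2) that by auto
      moreover have "B \<subseteq> f ` E" using multiplicative_class_subset[OF B] by auto
      moreover have "g (f x) = x" if "x \<in> E" for x using gf ET that by auto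
      ultimately show ?thesis using fE by force
    qed
    with multiplicative_class_preimage[OF g C(1)] show ?thesis by (rule bexI[rotated])
  qed
  with fE show ?thesis unfolding embedded_of_class_iff by simp
qed

lemma ex_homeomorphic_copy:
  assumes "inj_on h (topspace X)"
  shows "\<exists>Y g. homeomorphic_maps X Y h g"
proof -
  define g where "g = inv_into (topspace X) h"
  define Y where "Y = pullback_topology (h ` topspace X) g X"
  have gh: "g (h x) = x" if "x \<in> topspace X" for x
    using that assms by (simp add: g_def)
  have topY: "topspace Y = h ` topspace X"
    using gh by (auto simp: Y_def topspace_pullback_topology)
  have "continuous_map X Y h"
    unfolding continuous_map_def
  proof (intro conjI allI impI)
    show "h \<in> topspace X \<rightarrow> topspace Y" using topY by auto
    fix U assume "openin Y U"
    then obtain V where V: "openin X V" "U = g -` V \<inter> h ` topspace X"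
      unfolding Y_def openin_pullback_topology by auto
    have "{x \<in> topspace X. h x \<in> U} = V"
      using V(2) gh openin_subset[OF V(1)] by force
    with V(1) show "openin X {x \<in> topspace X. h x \<in> U}" by simp
  qed
  moreover have "continuous_map Y X g"
    using continuous_map_pullback[OF continuous_map_id, of "h ` topspace X" g X]
    by (simp add: Y_def o_def)
  ultimately have "homeomorphic_maps X Y h g"
    using gh topY by (auto simp: homeomorphic_maps_def)
  then show ?thesis by blast
qed

text \<open>
  A sequence of reals is determined by the Dedekind cuts of its entries, that is, by a set of pairs of
  a natural and a rational number, and there are only continuum many such sets.
\<close>

lemma ex_inj_sequences_to_real: "\<exists>j :: (nat \<Rightarrow> real) \<Rightarrow> real. inj j"
proof -
  obtain e :: "nat set \<Rightarrow> real" where e: "inj e"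
    using nat_sets_eqpoll_reals unfolding eqpoll_def bij_betw_def by auto
  define c where "c f = {(n :: nat, q :: rat). of_rat q < (f n :: real)}" for f
  have le: "f n \<le> g n" if "c f = c g" for f g n
  proof (rule ccontr)
    assume "\<not> f n \<le> g n"
    then obtain q where "g n < of_rat q" "of_rat q < f n"
      using of_rat_dense[of "g n" "f n"] by (auto simp: not_le)
    then have "(n, q) \<in> c f" "(n, q) \<notin> c g" by (auto simp: c_def)
    with that show False by simp
  qed
  have "inj c"
  proof (rule injI)
    fix f g assume "c f = c g"
    then show "f = g" using le[of f g] le[of g f] by (intro ext antisym) simp_all
  qed
  moreover have "inj (\<lambda>S :: (nat \<times> rat) set. to_nat ` S)"
    by (intro injI) (simp add: inj_image_eq_iff)
  ultimately have "inj (e \<circ> ((\<lambda>S. to_nat ` S) \<circ> c))"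
    using e by (intro inj_compose)
  then show ?thesis by blast
qed

lemma ex_inj_omega1_to_real: "\<exists>r :: omega1 \<Rightarrow> real. inj r"
proof -
  have "\<not> (card_of (UNIV :: real set), natLeq) \<in> ordLeq"
    using uncountable_UNIV_real countable_iff_ordLeq_natLeq by blast
  then have "(natLeq, card_of (UNIV :: real set)) \<in> ordLess"
    using not_ordLeq_iff_ordLess[OF natLeq_Well_order card_of_Well_order] by blast
  then have "(cardSuc natLeq, card_of (UNIV :: real set)) \<in> ordLeq"
    using cardSuc_ordLeq_ordLess[OF natLeq_Card_order card_of_Card_order]
      cardSuc_least[OF natLeq_Card_order card_of_Card_order] by blast
  then have "(card_of (Field (cardSuc natLeq)), card_of (UNIV :: real set)) \<in> ordLeq"
    using card_of_Field_ordIso[OF cardSuc_Card_order[OF natLeq_Card_order]] ordIso_ordLeq_trans by blast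
  then obtain g :: "_ \<Rightarrow> real" where g: "inj_on g (Field (cardSuc natLeq))"
    unfolding card_of_ordLeq[symmetric] by blast
  have "inj (\<lambda>a. g (Rep_omega1 a))"
    using g Rep_omega1 Rep_omega1_inject by (intro injI) (metis inj_onD)
  then show ?thesis by blast
qed

section \<open>Eventual constancy along the countable ordinals\<close>

text \<open>
  Convergence along strictly increasing sequences is the only consequence of continuity that is used.
  Without a bound on the oscillation by \<open>\<epsilon>\<close> beyond some ordinal, iterating a witness function would give
  a strictly increasing sequence whose values keep jumping by \<open>\<epsilon>\<close>. Since countably many ordinals are
  bounded, one ordinal serves all \<open>\<epsilon> = 1 / (k + 1)\<close>.
\<close>

lemma eventually_constant_omega1:
  fixes h :: "omega1 \<Rightarrow> real"
  assumes conv: "\<And>s. strict_mono s \<Longrightarrow> convergent (\<lambda>n::nat. h (s n))"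
  shows "\<exists>\<gamma>. \<forall>\<delta>\<ge>\<gamma>. h \<delta> = h \<gamma>"
proof -
  have osc: "\<exists>\<gamma>. \<forall>\<delta>\<ge>\<gamma>. \<bar>h \<delta> - h \<gamma>\<bar> < \<epsilon>" if "\<epsilon> > 0" for \<epsilon> :: real
  proof (rule ccontr)
    assume "\<not> ?thesis"
    then have "\<forall>\<gamma>. \<exists>\<delta>. \<gamma> \<le> \<delta> \<and> \<epsilon> \<le> \<bar>h \<delta> - h \<gamma>\<bar>"
      by (simp add: not_less)
    from choice[OF this] obtain g where g: "\<And>\<gamma>. \<gamma> \<le> g \<gamma>" "\<And>\<gamma>. \<epsilon> \<le> \<bar>h (g \<gamma>) - h \<gamma>\<bar>" by blast
    have "g \<gamma> \<noteq> \<gamma>" for \<gamma> using g(2)[of \<gamma>] that by auto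
    with g(1) have less: "\<gamma> < g \<gamma>" for \<gamma> by (metis order.not_eq_order_implies_strict)
    define s where "s n = (g ^^ n) 0" for n
    have s: "s (Suc n) = g (s n)" for n by (simp add: s_def)
    have "strict_mono s" unfolding strict_mono_Suc_iff s using less by blast
    then obtain l where l: "(\<lambda>n. h (s n)) \<longlonglongrightarrow> l" using conv convergent_def by blast
    have "(\<lambda>n. \<bar>h (s (Suc n)) - h (s n)\<bar>) \<longlonglongrightarrow> \<bar>l - l\<bar>"
      by (intro tendsto_intros l LIMSEQ_Suc)
    then have "\<forall>\<^sub>F n in sequentially. \<bar>h (s (Suc n)) - h (s n)\<bar> < \<epsilon>"
      using that by (intro order_tendstoD(2)) auto
    then obtain n where "\<bar>h (s (Suc n)) - h (s n)\<bar> < \<epsilon>"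
      unfolding eventually_sequentially by blast
    with g(2)[of "s n"] show False unfolding s by simp
  qed
  have "\<forall>k. \<exists>\<gamma>. \<forall>\<delta>\<ge>\<gamma>. \<bar>h \<delta> - h \<gamma>\<bar> < inverse (real (Suc k))"
    by (intro allI osc) simp
  from choice[OF this] obtain G where G: "\<And>k \<delta>. G k \<le> \<delta> \<Longrightarrow> \<bar>h \<delta> - h (G k)\<bar> < inverse (real (Suc k))"
    by blast
  obtain \<gamma> where \<gamma>: "\<And>k. G k \<le> \<gamma>"
    using countable_bounded_omega1[of "range G"] by auto
  have "h \<delta> = h \<gamma>" if "\<gamma> \<le> \<delta>" for \<delta>
  proof (rule ccontr)
    assume "h \<delta> \<noteq> h \<gamma>"
    then obtain k where k: "inverse (real (Suc k)) < \<bar>h \<delta> - h \<gamma>\<bar> / 2"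
      using reals_Archimedean[of "\<bar>h \<delta> - h \<gamma>\<bar> / 2"] by auto
    have "G k \<le> \<delta>" using \<gamma>[of k] that by simp
    have "\<bar>h \<delta> - h \<gamma>\<bar> \<le> \<bar>h \<delta> - h (G k)\<bar> + \<bar>h \<gamma> - h (G k)\<bar>" by linarith
    also have "\<dots> < inverse (real (Suc k)) + inverse (real (Suc k))"
      by (intro add_strict_mono G \<open>G k \<le> \<delta>\<close> \<gamma>)
    also have "\<dots> < \<bar>h \<delta> - h \<gamma>\<bar>"
      using add_strict_mono[OF k k] by (simp only: field_sum_of_halves)
    finally show False .
  qed
  then show ?thesis by blast
qed

text \<open>
  A set of the hierarchy is obtained from functions by countably many operations, so an invariance
  that each function has beyond some ordinal is inherited. The relation \<open>R \<gamma>\<close> is meant to hold between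
  points that differ only in a coordinate beyond \<open>\<gamma>\<close>.
\<close>

lemma additive_class_eventually_invariant:
  assumes anti: "\<And>\<gamma> \<delta> p p'. \<gamma> \<le> \<delta> \<Longrightarrow> R \<delta> p p' \<Longrightarrow> R \<gamma> p p'"
    and top: "\<And>\<gamma> p p'. R \<gamma> p p' \<Longrightarrow> p \<in> topspace X \<and> p' \<in> topspace X"
    and cont: "\<And>f. continuous_map X euclideanreal f \<Longrightarrow> \<exists>\<gamma>::omega1. \<forall>p p'. R \<gamma> p p' \<longrightarrow> f p = f p'"
  shows "S \<in> additive_class X \<alpha> \<Longrightarrow> \<exists>\<gamma>. \<forall>p p'. R \<gamma> p p' \<longrightarrow> (p \<in> S \<longleftrightarrow> p' \<in> S)"
proof (induction \<alpha> arbitrary: S rule: less_induct)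
  case (less \<alpha>)
  show ?case
  proof (cases "\<alpha> = 0")
    case True
    then obtain f where f: "continuous_map X euclideanreal f" "S = topspace X - {x \<in> topspace X. f x = 0}"
      using less.prems by (auto simp: additive_class_0 functionally_open_def)
    obtain \<gamma> where \<gamma>: "\<And>p p'. R \<gamma> p p' \<Longrightarrow> f p = f p'" using cont[OF f(1)] by blast
    have "p \<in> S \<longleftrightarrow> p' \<in> S" if "R \<gamma> p p'" for p p'
      using top[OF that] \<gamma>[OF that] f(2) by simp
    then show ?thesis by blast
  next
    case False
    then obtain T where T: "S = (\<Union>n::nat. T n)" "\<And>n. \<exists>\<xi><\<alpha>. T n \<in> multiplicative_class X \<xi>"
      using less.prems by (auto simp: additive_class_iff)
    have "\<exists>\<gamma>. \<forall>p p'. R \<gamma> p p' \<longrightarrow> (p \<in> T n \<longleftrightarrow> p' \<in> T n)" for n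
    proof -
      obtain \<xi> where \<xi>: "\<xi> < \<alpha>" "topspace X - T n \<in> additive_class X \<xi>"
        using T(2)[of n] multiplicative_class_iff by auto
      from less.IH[OF \<xi>] obtain \<gamma> where
        \<gamma>: "\<And>p p'. R \<gamma> p p' \<Longrightarrow> p \<in> topspace X - T n \<longleftrightarrow> p' \<in> topspace X - T n" by auto
      have "p \<in> T n \<longleftrightarrow> p' \<in> T n" if "R \<gamma> p p'" for p p'
        using \<gamma>[OF that] top[OF that] by simp
      then show ?thesis by blast
    qed
    then have "\<forall>n. \<exists>\<gamma>. \<forall>p p'. R \<gamma> p p' \<longrightarrow> (p \<in> T n \<longleftrightarrow> p' \<in> T n)" ..
    from choice[OF this] obtain G where
      G: "\<And>n p p'. R (G n) p p' \<Longrightarrow> p \<in> T n \<longleftrightarrow> p' \<in> T n" by blast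
    obtain \<gamma> where \<gamma>: "\<And>n. G n \<le> \<gamma>"
      using countable_bounded_omega1[of "range G"] by auto
    have "p \<in> S \<longleftrightarrow> p' \<in> S" if "R \<gamma> p p'" for p p'
      unfolding T(1) using G[OF anti[OF \<gamma> that]] by simp
    then show ?thesis by blast
  qed
qed

lemma multiplicative_class_eventually_invariant:
  assumes anti: "\<And>\<gamma> \<delta> p p'. \<gamma> \<le> \<delta> \<Longrightarrow> R \<delta> p p' \<Longrightarrow> R \<gamma> p p'"
    and top: "\<And>\<gamma> p p'. R \<gamma> p p' \<Longrightarrow> p \<in> topspace X \<and> p' \<in> topspace X"
    and cont: "\<And>f. continuous_map X euclideanreal f \<Longrightarrow> \<exists>\<gamma>::omega1. \<forall>p p'. R \<gamma> p p' \<longrightarrow> f p = f p'"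
    and S: "S \<in> multiplicative_class X \<alpha>"
  shows "\<exists>\<gamma>. \<forall>p p'. R \<gamma> p p' \<longrightarrow> (p \<in> S \<longleftrightarrow> p' \<in> S)"
proof -
  have "\<exists>\<gamma>. \<forall>p p'. R \<gamma> p p' \<longrightarrow> (p \<in> topspace X - S \<longleftrightarrow> p' \<in> topspace X - S)"
    by (rule additive_class_eventually_invariant[OF anti top cont])
      (use S in \<open>auto simp: multiplicative_class_iff\<close>)
  then obtain \<gamma> where \<gamma>: "\<And>p p'. R \<gamma> p p' \<Longrightarrow> p \<in> topspace X - S \<longleftrightarrow> p' \<in> topspace X - S" by auto
  have "p \<in> S \<longleftrightarrow> p' \<in> S" if "R \<gamma> p p'" for p p'
    using \<gamma>[OF that] top[OF that] by simp
  then show ?thesis by blast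
qed

section \<open>The plank\<close>

text \<open>
  The extra point \<open>None\<close> plays the role of \<open>\<infinity>\<close>, the last point of \<open>\<omega>\<^sub>1 + 1\<close>.
\<close>

definition below :: "omega1 option \<Rightarrow> omega1 \<Rightarrow> bool" where
  "below q \<delta> = (case q of None \<Rightarrow> False | Some \<gamma> \<Rightarrow> \<gamma> \<le> \<delta>)"

lemma below_simps [simp]: "\<not> below None \<delta>" "below (Some \<gamma>) \<delta> \<longleftrightarrow> \<gamma> \<le> \<delta>"
  by (simp_all add: below_def)

definition beyond :: "omega1 \<Rightarrow> omega1 option \<Rightarrow> bool" where
  "beyond \<gamma> q = (case q of None \<Rightarrow> True | Some \<delta> \<Rightarrow> \<gamma> \<le> \<delta>)"

lemma beyond_simps [simp]: "beyond \<gamma> None" "beyond \<gamma> (Some \<delta>) \<longleftrightarrow> \<gamma> \<le> \<delta>"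
  by (simp_all add: beyond_def)

lemma beyond_anti: "\<gamma> \<le> \<delta> \<Longrightarrow> beyond \<delta> q \<Longrightarrow> beyond \<gamma> q"
  by (auto simp: beyond_def split: option.splits)

type_synonym point = "(nat \<Rightarrow> real) \<times> (omega1 \<times> bool \<Rightarrow> bool)"

text \<open>
  The order topology of \<open>\<omega>\<^sub>1 + 1\<close> is generated by the initial segments \<open>[0, \<delta>]\<close> with \<open>\<delta> < \<omega>\<^sub>1\<close> and their
  complements, so \<open>\<omega>\<^sub>1 + 1\<close> embeds into a power of the discrete two-point space by its characteristic
  functions. With one family of them for each of the two copies, glued at \<open>\<infinity>\<close>, the plank becomes a
  subspace of a product, and its complete regularity and separation come for free.
\<close>

definition ambient :: "point topology" where
  "ambient = prod_topology euclidean (product_topology (\<lambda>_. discrete_topology UNIV) UNIV)"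

definition pt :: "(nat \<Rightarrow> real) set \<Rightarrow> (nat \<Rightarrow> real) \<Rightarrow> omega1 option \<Rightarrow> point" where
  "pt A x q = (x, \<lambda>(\<delta>, b). (x \<in> A \<longleftrightarrow> b) \<and> below q \<delta>)"

definition all_pts :: "(nat \<Rightarrow> real) set \<Rightarrow> point set" where
  "all_pts A = range (\<lambda>(x, q). pt A x q)"

definition low_pts :: "(nat \<Rightarrow> real) set \<Rightarrow> point set" where
  "low_pts A = range (\<lambda>(x, \<gamma>). pt A x (Some \<gamma>))"

lemma low_ptsE:
  assumes "p \<in> low_pts A"
  obtains x \<gamma> where "p = pt A x (Some \<gamma>)"
proof -
  from assms obtain z where "p = (case z of (x, \<gamma>) \<Rightarrow> pt A x (Some \<gamma>))"
    unfolding low_pts_def by (rule rangeE)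
  then show thesis by (cases z) (simp add: that)
qed

lemma fst_pt [simp]: "fst (pt A x q) = x"
  by (simp add: pt_def)

lemma snd_pt: "snd (pt A x q) (\<delta>, b) \<longleftrightarrow> (x \<in> A \<longleftrightarrow> b) \<and> below q \<delta>"
  by (simp add: pt_def)

lemma inj_pt: "inj (\<lambda>(x, q). pt A x q)"
proof (rule injI, clarify)
  fix x q x' q' assume eq: "pt A x q = pt A x' q'"
  from arg_cong[OF this, of fst] have "x = x'" by simp
  moreover have "below q \<delta> \<longleftrightarrow> below q' \<delta>" for \<delta>
    using arg_cong[OF eq, of "\<lambda>p. snd p (\<delta>, x \<in> A)"] \<open>x = x'\<close> by (simp add: snd_pt)
  then have "q = q'"
    by (cases q; cases q') (auto intro: antisym)
  ultimately show "x = x' \<and> q = q'" by simp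
qed

lemma pt_eq_iff [simp]: "pt A x q = pt A x' q' \<longleftrightarrow> x = x' \<and> q = q'"
  using inj_pt[of A] by (auto dest: injD[where x = "(x, q)" and y = "(x', q')"])

lemma pt_in_all [simp]: "pt A x q \<in> all_pts A"
  by (auto simp: all_pts_def)

lemma pt_in_low [simp]: "pt A x q \<in> low_pts A \<longleftrightarrow> q \<noteq> None"
  by (auto simp: low_pts_def)

lemma low_subset_all: "low_pts A \<subseteq> all_pts A"
  by (auto simp: low_pts_def)

lemma topspace_ambient [simp]: "topspace ambient = UNIV"
  by (simp add: ambient_def)

lemma continuous_map_fst_ambient: "continuous_map ambient euclidean fst"
  unfolding ambient_def by (rule continuous_map_fst)

lemma continuous_map_coord_ambient:
  "continuous_map ambient (discrete_topology UNIV) (\<lambda>p. snd p i)"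
proof -
  have "continuous_map ambient (discrete_topology UNIV) ((\<lambda>u. u i) \<circ> snd)"
    unfolding ambient_def
    by (rule continuous_map_compose[OF continuous_map_snd]) (rule continuous_map_product_projection, simp)
  then show ?thesis by (simp add: o_def)
qed

lemma continuous_map_into_ambient:
  assumes "continuous_map Z euclidean (\<lambda>z. fst (f z))"
    and "\<And>i. continuous_map Z (discrete_topology UNIV) (\<lambda>z. snd (f z) i)"
  shows "continuous_map Z ambient f"
  using assms unfolding ambient_def continuous_map_pairwise o_def continuous_map_componentwise_UNIV by blast

text \<open>
  At a fixed ordinal the points over \<open>A\<close> and those over its complement are kept apart by the two-valued
  coordinates, so only the restriction to one of these sets is continuous.
\<close>

lemma continuous_map_pt_slice:
  "continuous_map (top_of_set {x. x \<in> A \<longleftrightarrow> b}) ambient (\<lambda>x. pt A x q)"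
proof (rule continuous_map_into_ambient)
  show "continuous_map (top_of_set {x. x \<in> A \<longleftrightarrow> b}) euclidean (\<lambda>x. fst (pt A x q))"
    by simp
  fix i :: "omega1 \<times> bool"
  have "continuous_map (top_of_set {x. x \<in> A \<longleftrightarrow> b}) (discrete_topology UNIV)
      (\<lambda>_. b = snd i \<and> below q (fst i))"
    by simp
  then show "continuous_map (top_of_set {x. x \<in> A \<longleftrightarrow> b}) (discrete_topology UNIV) (\<lambda>x. snd (pt A x q) i)"
    by (rule continuous_map_eq) (cases i, auto simp: snd_pt)
qed

lemma continuous_map_pt_None: "continuous_map euclidean ambient (\<lambda>x. pt A x None)"
proof (rule continuous_map_into_ambient)
  show "continuous_map euclidean (discrete_topology UNIV) (\<lambda>x. snd (pt A x None) i)" for i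
    by (cases i) (simp add: snd_pt)
qed simp

lemma limitin_ambient_pt:
  assumes "\<And>\<delta>. \<forall>\<^sub>F n in F. below (q n) \<delta> \<longleftrightarrow> below l \<delta>"
  shows "limitin ambient (\<lambda>n. pt A x (q n)) (pt A x l) F"
proof -
  have "\<forall>\<^sub>F n in F. snd (pt A x (q n)) i = snd (pt A x l) i" for i
    using assms[of "fst i"] by (cases i) (auto simp: snd_pt elim: eventually_mono)
  then have "limitin (discrete_topology UNIV) (\<lambda>n. snd (pt A x (q n)) i) (snd (pt A x l) i) F" for i
    by (intro limitin_eventually) simp_all
  then show ?thesis
    unfolding ambient_def limitin_pairwise limitin_componentwise by (simp add: o_def)
qed

text \<open>
  Every strictly increasing sequence of countable ordinals has a supremum in \<open>\<omega>\<^sub>1\<close> and converges to it.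
\<close>

lemma limitin_ambient_pt_increasing:
  assumes "strict_mono (s :: nat \<Rightarrow> omega1)"
  shows "\<exists>l. limitin ambient (\<lambda>n. pt A x (Some (s n))) (pt A x (Some l)) sequentially"
proof -
  obtain u where u: "\<And>n. s n \<le> u"
    using countable_bounded_omega1[of "range s"] by auto
  define l where "l = (LEAST u. \<forall>n. s n \<le> u)"
  have l: "s n \<le> l" for n
    unfolding l_def using LeastI[of "\<lambda>u. \<forall>n. s n \<le> u" u] u by blast
  have least: "l \<le> v" if "\<And>n. s n \<le> v" for v
    unfolding l_def using that by (intro Least_le) blast
  have "\<forall>\<^sub>F n in sequentially. below (Some (s n)) \<delta> \<longleftrightarrow> below (Some l) \<delta>" for \<delta>
  proof (cases "l \<le> \<delta>")
    case True
    then show ?thesis using l order_trans by (intro always_eventually) (auto intro: order_trans)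
  next
    case False
    then obtain m where "\<not> s m \<le> \<delta>" using least by blast
    moreover have "s m \<le> s n" if "m \<le> n" for n
      using assms that by (simp add: strict_mono_less_eq)
    ultimately have "\<not> s n \<le> \<delta>" if "m \<le> n" for n using that order_trans by blast
    with False show ?thesis unfolding eventually_sequentially by auto
  qed
  then have "limitin ambient (\<lambda>n. pt A x (Some (s n))) (pt A x (Some l)) sequentially"
    by (rule limitin_ambient_pt)
  then show ?thesis ..
qed

lemma limitin_ambient_pt_at_top:
  "limitin ambient (\<lambda>\<gamma>. pt A x (Some \<gamma>)) (pt A x None) at_top"
proof (rule limitin_ambient_pt)
  show "\<forall>\<^sub>F \<gamma> in at_top. below (Some \<gamma>) \<delta> \<longleftrightarrow> below None \<delta>" for \<delta>
    using eventually_ge_at_top[of "succ \<delta>"] by eventually_elim (use less_succ[of \<delta>] in auto)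
qed

text \<open>
  Over each single \<open>x\<close> there is an ordinal beyond which the function is constant. The supremum over a
  countable dense subset of \<open>A\<close> (or of its complement) is an ordinal beyond which all slices agree on
  that dense subset, hence everywhere by continuity of the slices. The value at \<open>\<infinity>\<close>, if \<open>M\<close> contains that
  point, is the limit.
\<close>

lemma real_function_eventually_constant:
  assumes low: "low_pts A \<subseteq> M" and f: "continuous_map (subtopology ambient M) euclideanreal f"
  shows "\<exists>\<gamma>. \<forall>x q q'. pt A x q \<in> M \<longrightarrow> pt A x q' \<in> M \<longrightarrow> beyond \<gamma> q \<longrightarrow> beyond \<gamma> q' \<longrightarrow>
    f (pt A x q) = f (pt A x q')"
proof -
  have inM: "pt A x (Some \<gamma>) \<in> M" for x \<gamma>
    using low by (auto simp: low_pts_def)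
  have pointwise: "\<exists>\<gamma>. \<forall>\<delta>\<ge>\<gamma>. f (pt A x (Some \<delta>)) = f (pt A x (Some \<gamma>))" for x
  proof (rule eventually_constant_omega1)
    fix s :: "nat \<Rightarrow> omega1" assume "strict_mono s"
    from limitin_ambient_pt_increasing[OF this] obtain l where
      "limitin ambient (\<lambda>n. pt A x (Some (s n))) (pt A x (Some l)) sequentially" by blast
    then have "limitin (subtopology ambient M) (\<lambda>n. pt A x (Some (s n))) (pt A x (Some l)) sequentially"
      using inM by (simp add: limitin_subtopology)
    from continuous_map_limit[OF f this]
    have "(\<lambda>n. f (pt A x (Some (s n)))) \<longlonglongrightarrow> f (pt A x (Some l))" by (simp add: o_def)
    then show "convergent (\<lambda>n. f (pt A x (Some (s n))))" unfolding convergent_def by blast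
  qed
  have "\<exists>\<gamma>. \<forall>\<delta>\<ge>\<gamma>. \<forall>x. (x \<in> A \<longleftrightarrow> b) \<longrightarrow> f (pt A x (Some \<delta>)) = f (pt A x (Some \<gamma>))" for b
  proof -
    let ?S = "{x. x \<in> A \<longleftrightarrow> b}"
    obtain D where D: "countable D" "D \<subseteq> ?S" "?S \<subseteq> closure D"
      using separable[of ?S] by metis
    have "\<forall>x. \<exists>\<gamma>. \<forall>\<delta>\<ge>\<gamma>. f (pt A x (Some \<delta>)) = f (pt A x (Some \<gamma>))"
      using pointwise by (intro allI)
    from choice[OF this] obtain G where
      G: "\<And>x \<delta>. G x \<le> \<delta> \<Longrightarrow> f (pt A x (Some \<delta>)) = f (pt A x (Some (G x)))" by blast
    obtain \<gamma> where \<gamma>: "\<And>x. x \<in> D \<Longrightarrow> G x \<le> \<gamma>"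
      using countable_bounded_omega1[of "G ` D"] D(1) by auto
    have cont: "continuous_on ?S (\<lambda>x. f (pt A x (Some \<delta>)))" for \<delta>
    proof -
      have "continuous_map (top_of_set ?S) (subtopology ambient M) (\<lambda>x. pt A x (Some \<delta>))"
        using continuous_map_pt_slice inM by (simp add: continuous_map_in_subtopology image_subset_iff)
      from continuous_map_compose[OF this f] show ?thesis by (simp add: o_def)
    qed
    have "f (pt A x (Some \<delta>)) = f (pt A x (Some \<gamma>))" if "\<gamma> \<le> \<delta>" "x \<in> ?S" for x \<delta>
    proof -
      have "continuous_on ?S (\<lambda>x. f (pt A x (Some \<delta>)) - f (pt A x (Some \<gamma>)))"
        by (intro continuous_on_diff cont)
      then have "closedin (top_of_set ?S) {x \<in> ?S. f (pt A x (Some \<delta>)) - f (pt A x (Some \<gamma>)) = 0}"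
        by (rule continuous_closedin_preimage_constant)
      then obtain C where C: "closed C"
        "{x \<in> ?S. f (pt A x (Some \<delta>)) - f (pt A x (Some \<gamma>)) = 0} = ?S \<inter> C"
        unfolding closedin_closed by blast
      have "D \<subseteq> C"
      proof
        fix d assume d: "d \<in> D"
        then have "f (pt A d (Some \<delta>)) = f (pt A d (Some \<gamma>))"
          using G[of d \<delta>] G[of d \<gamma>] \<gamma>[OF d] that(1) by simp
        then have "d \<in> {x \<in> ?S. f (pt A x (Some \<delta>)) - f (pt A x (Some \<gamma>)) = 0}"
          using d D(2) by auto
        then show "d \<in> C" unfolding C(2) by blast
      qed
      then have "x \<in> ?S \<inter> C"
        using D(3) \<open>x \<in> ?S\<close> closure_minimal[OF _ C(1)] by blast
      then show ?thesis unfolding C(2)[symmetric] by simp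
    qed
    then show ?thesis by blast
  qed
  then have "\<forall>b. \<exists>\<gamma>. \<forall>\<delta>\<ge>\<gamma>. \<forall>x. (x \<in> A \<longleftrightarrow> b) \<longrightarrow> f (pt A x (Some \<delta>)) = f (pt A x (Some \<gamma>))"
    by (intro allI)
  from choice[OF this] obtain G where
    G: "\<And>b \<delta> x. G b \<le> \<delta> \<Longrightarrow> (x \<in> A \<longleftrightarrow> b) \<Longrightarrow> f (pt A x (Some \<delta>)) = f (pt A x (Some (G b)))" by blast
  define \<gamma> where "\<gamma> = max (G True) (G False)"
  have "G b \<le> \<gamma>" for b by (cases b) (simp_all add: \<gamma>_def)
  then have const: "f (pt A x (Some \<delta>)) = f (pt A x (Some \<gamma>))" if "\<gamma> \<le> \<delta>" for \<delta> x
    using G[of "x \<in> A" \<delta> x] G[of "x \<in> A" \<gamma> x] that by (metis order_trans)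
  have "f (pt A x q) = f (pt A x (Some \<gamma>))" if q: "pt A x q \<in> M" "beyond \<gamma> q" for x q
  proof (cases q)
    case None
    have "limitin (subtopology ambient M) (\<lambda>\<delta>. pt A x (Some \<delta>)) (pt A x q) at_top"
      using limitin_ambient_pt_at_top inM q None by (simp add: limitin_subtopology)
    from continuous_map_limit[OF f this]
    have "((\<lambda>\<delta>. f (pt A x (Some \<delta>))) \<longlongrightarrow> f (pt A x q)) at_top" by (simp add: o_def)
    moreover have "((\<lambda>\<delta>. f (pt A x (Some \<delta>))) \<longlongrightarrow> f (pt A x (Some \<gamma>))) at_top"
      by (rule tendsto_eventually, rule eventually_mono[OF eventually_ge_at_top[of \<gamma>]], rule const)
    ultimately show ?thesis
      by (rule tendsto_unique[OF trivial_limit_at_top_linorder])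
  next
    case (Some \<delta>)
    then show ?thesis using const[of \<delta> x] q(2) by simp
  qed
  then have "f (pt A x q) = f (pt A x q')"
    if "pt A x q \<in> M" "pt A x q' \<in> M" "beyond \<gamma> q" "beyond \<gamma> q'" for x q q'
    using that by simp
  then show ?thesis by blast
qed

lemma multiplicative_class_eventually_constant:
  assumes low: "low_pts A \<subseteq> M" and S: "S \<in> multiplicative_class (subtopology ambient M) \<alpha>"
  shows "\<exists>\<gamma>. \<forall>x q q'. pt A x q \<in> M \<longrightarrow> pt A x q' \<in> M \<longrightarrow> beyond \<gamma> q \<longrightarrow> beyond \<gamma> q' \<longrightarrow>
    (pt A x q \<in> S \<longleftrightarrow> pt A x q' \<in> S)"
proof -
  define R where "R \<gamma> p p' \<longleftrightarrow> p \<in> M \<and> p' \<in> M \<and>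
    (\<exists>x q q'. p = pt A x q \<and> p' = pt A x q' \<and> beyond \<gamma> q \<and> beyond \<gamma> q')" for \<gamma> p p'
  have "\<exists>\<gamma>. \<forall>p p'. R \<gamma> p p' \<longrightarrow> (p \<in> S \<longleftrightarrow> p' \<in> S)"
  proof (rule multiplicative_class_eventually_invariant[OF _ _ _ S])
    show "R \<gamma> p p'" if "\<gamma> \<le> \<delta>" "R \<delta> p p'" for \<gamma> \<delta> p p'
      using that beyond_anti[OF that(1)] unfolding R_def by metis
    show "p \<in> topspace (subtopology ambient M) \<and> p' \<in> topspace (subtopology ambient M)"
      if "R \<gamma> p p'" for \<gamma> p p'
      using that by (simp add: R_def)
    show "\<exists>\<gamma>. \<forall>p p'. R \<gamma> p p' \<longrightarrow> f p = f p'"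
      if f: "continuous_map (subtopology ambient M) euclideanreal f" for f
      using real_function_eventually_constant[OF low f] unfolding R_def by metis
  qed
  then show ?thesis unfolding R_def by metis
qed

section \<open>The embedding properties of the plank\<close>

definition plank :: "(nat \<Rightarrow> real) set \<Rightarrow> point topology" where
  "plank A = subtopology ambient (all_pts A)"

lemma topspace_plank [simp]: "topspace (plank A) = all_pts A"
  by (simp add: plank_def)

lemma subtopology_plank: "subtopology (plank A) (low_pts A) = subtopology ambient (low_pts A)"
  using low_subset_all[of A] by (simp add: plank_def subtopology_subtopology Int_absorb1)

lemma completely_regular_plank: "completely_regular_space (plank A)"
proof -
  have "completely_regular_space (euclidean :: (nat \<Rightarrow> real) topology)"
    by (rule metrizable_imp_completely_regular_space[OF metrizable_space_euclidean])
  then show ?thesis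
    unfolding plank_def ambient_def
    by (intro completely_regular_space_subtopology)
      (simp add: completely_regular_space_prod_topology completely_regular_space_product_topology
        completely_regular_space_discrete_topology)
qed

lemma Hausdorff_plank: "Hausdorff_space (plank A)"
  unfolding plank_def ambient_def
  by (intro Hausdorff_space_subtopology)
    (simp add: Hausdorff_space_prod_topology Hausdorff_space_product_topology Hausdorff_space_euclidean
      Hausdorff_space_discrete_topology)

lemma functionally_closed_clopen:
  assumes U: "openin X U" and V: "openin X (topspace X - U)"
  shows "functionally_closed X U"
proof -
  define f :: "'a \<Rightarrow> real" where "f x = (if x \<in> U then 0 else 1)" for x
  have "continuous_map X euclideanreal f"
    unfolding continuous_map_def
  proof (intro conjI allI impI)
    show "f \<in> topspace X \<rightarrow> topspace euclideanreal" by simp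
    fix S :: "real set"
    have "{x \<in> topspace X. f x \<in> S} = (if 0 \<in> S then U else {}) \<union> (if 1 \<in> S then topspace X - U else {})"
      using openin_subset[OF U] by (auto simp: f_def)
    then show "openin X {x \<in> topspace X. f x \<in> S}"
      using U V by (simp add: openin_Un)
  qed
  moreover have "U = {x \<in> topspace X. f x = 0}"
    using openin_subset[OF U] by (auto simp: f_def)
  ultimately show ?thesis unfolding functionally_closed_iff by blast
qed

lemma coordinate_openin:
  "openin (subtopology ambient M) {p \<in> M. snd p i}" "openin (subtopology ambient M) {p \<in> M. \<not> snd p i}"
proof -
  have cont: "continuous_map (subtopology ambient M) (discrete_topology UNIV) (\<lambda>p. snd p i)"
    by (intro continuous_map_from_subtopology continuous_map_coord_ambient)
  show "openin (subtopology ambient M) {p \<in> M. snd p i}" "openin (subtopology ambient M) {p \<in> M. \<not> snd p i}"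
    using openin_continuous_map_preimage[OF cont, of "{True}"]
      openin_continuous_map_preimage[OF cont, of "{False}"] by simp_all
qed

lemma coordinate_additive:
  "{p \<in> M. snd p i} \<in> additive_class (subtopology ambient M) \<alpha>"
  "{p \<in> M. \<not> snd p i} \<in> additive_class (subtopology ambient M) \<alpha>"
proof -
  have compl: "M - {p \<in> M. snd p i} = {p \<in> M. \<not> snd p i}" "M - {p \<in> M. \<not> snd p i} = {p \<in> M. snd p i}"
    by auto
  have "functionally_open (subtopology ambient M) {p \<in> M. snd p i}"
    "functionally_open (subtopology ambient M) {p \<in> M. \<not> snd p i}"
    unfolding functionally_open_iff using coordinate_openin[where M = M and i = i]
    by (auto simp: compl intro: functionally_closed_clopen)
  then show "{p \<in> M. snd p i} \<in> additive_class (subtopology ambient M) \<alpha>"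
    "{p \<in> M. \<not> snd p i} \<in> additive_class (subtopology ambient M) \<alpha>"
    using additive_class_mono[OF zero_le_omega1, of "subtopology ambient M" \<alpha>]
    by (auto simp: additive_class_0)
qed

text \<open>
  The points over \<open>A\<close> form a clopen set in the absence of \<open>\<infinity>\<close>: a point \<open>(x, \<gamma>)\<close> of the first copy is
  recognised by the open condition of lying in some initial segment \<open>[0, \<delta>]\<close> of that copy.
\<close>

lemma half_multiplicative:
  "{p \<in> low_pts A. fst p \<in> A} \<in> multiplicative_class (subtopology ambient (low_pts A)) \<alpha>"
proof -
  have open_half: "openin (subtopology ambient (low_pts A)) {p \<in> low_pts A. fst p \<in> A \<longleftrightarrow> b}" for b
  proof -
    have "(\<exists>\<delta>. snd p (\<delta>, b)) \<longleftrightarrow> (fst p \<in> A \<longleftrightarrow> b)" if "p \<in> low_pts A" for p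
    proof -
      obtain x \<gamma> where "p = pt A x (Some \<gamma>)" using \<open>p \<in> low_pts A\<close> by (rule low_ptsE)
      then show ?thesis by (auto simp: snd_pt)
    qed
    then have "{p \<in> low_pts A. fst p \<in> A \<longleftrightarrow> b} = (\<Union>\<delta>. {p \<in> low_pts A. snd p (\<delta>, b)})"
      by blast
    then show ?thesis
      by (auto intro!: openin_Union coordinate_openin)
  qed
  have "low_pts A - {p \<in> low_pts A. fst p \<in> A} = {p \<in> low_pts A. fst p \<in> A \<longleftrightarrow> False}" by auto
  then have "functionally_closed (subtopology ambient (low_pts A)) {p \<in> low_pts A. fst p \<in> A}"
    using open_half[of True] open_half[of False] by (intro functionally_closed_clopen) simp_all
  then show ?thesis
    using multiplicative_class_mono[OF zero_le_omega1, of "subtopology ambient (low_pts A)" \<alpha>]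
    by (auto simp: multiplicative_class_0)
qed

text \<open>
  Beyond some ordinal, a set \<open>C\<close> that cuts out the points over \<open>A\<close> is the same at \<open>\<gamma>\<close> and at \<open>\<infinity>\<close>, so its
  slice at \<open>\<infinity>\<close> is \<open>A\<close>. That slice is the preimage of \<open>C\<close> under the embedding \<open>x \<mapsto> (x, \<infinity>)\<close> of the
  whole base.
\<close>

lemma not_embedded_plank:
  assumes A: "A \<notin> multiplicative_class euclidean \<alpha>"
  shows "\<not> embedded_of_class \<alpha> (plank A) (low_pts A)"
proof
  assume "embedded_of_class \<alpha> (plank A) (low_pts A)"
  then have "\<forall>B \<in> multiplicative_class (subtopology ambient (low_pts A)) \<alpha>.
      \<exists>C \<in> multiplicative_class (plank A) \<alpha>. C \<inter> low_pts A = B"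
    unfolding embedded_of_class_iff subtopology_plank by (rule conjunct2)
  from bspec[OF this half_multiplicative] obtain C where
    C: "C \<in> multiplicative_class (plank A) \<alpha>" "C \<inter> low_pts A = {p \<in> low_pts A. fst p \<in> A}" ..
  from multiplicative_class_eventually_constant[OF low_subset_all C(1)[unfolded plank_def]]
  obtain \<gamma> where eventual: "\<forall>x q q'. pt A x q \<in> all_pts A \<longrightarrow> pt A x q' \<in> all_pts A \<longrightarrow> beyond \<gamma> q \<longrightarrow>
      beyond \<gamma> q' \<longrightarrow> (pt A x q \<in> C \<longleftrightarrow> pt A x q' \<in> C)" ..
  have \<gamma>: "pt A x None \<in> C \<longleftrightarrow> pt A x (Some \<gamma>) \<in> C" for x
    using eventual[rule_format, of x None "Some \<gamma>"] by simp
  have "pt A x (Some \<gamma>) \<in> C \<longleftrightarrow> x \<in> A" for x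
  proof -
    have "pt A x (Some \<gamma>) \<in> C \<inter> low_pts A \<longleftrightarrow> x \<in> A" unfolding C(2) by simp
    then show ?thesis by simp
  qed
  with \<gamma> have "{x. pt A x None \<in> C} = A" by simp
  moreover have "{x. pt A x None \<in> C} \<in> multiplicative_class euclidean \<alpha>"
  proof -
    have "continuous_map euclidean (plank A) (\<lambda>x. pt A x None)"
      using continuous_map_pt_None by (simp add: plank_def continuous_map_in_subtopology)
    from multiplicative_class_preimage[OF this C(1)] show ?thesis by simp
  qed
  ultimately show False using A by simp
qed

definition level :: "(nat \<Rightarrow> real) set \<Rightarrow> omega1 \<times> bool \<Rightarrow> point set" where
  "level A i = {p \<in> all_pts A. snd p i \<and> (\<forall>\<delta><fst i. \<not> snd p (\<delta>, snd i))}"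

lemma pt_in_level: "pt A x (Some \<gamma>) \<in> level A i \<longleftrightarrow> i = (\<gamma>, x \<in> A)"
proof (cases i)
  case (Pair \<delta> b)
  have "\<gamma> \<le> \<delta> \<and> (\<forall>\<beta><\<delta>. \<not> \<gamma> \<le> \<beta>) \<longleftrightarrow> \<delta> = \<gamma>" by force
  then show ?thesis using Pair by (auto simp: level_def snd_pt)
qed

text \<open>
  The predecessors of a countable ordinal are countably many, so a level is a countable intersection of
  clopen sets, that is, a zero set. Zero sets belong to every additive class of positive
  index, and \<open>\<alpha> + 1\<close> is such an index.
\<close>

lemma level_additive: "\<eta> \<noteq> 0 \<Longrightarrow> level A i \<in> additive_class (plank A) \<eta>"
proof -
  assume "\<eta> \<noteq> 0"
  have "topspace (plank A) - level A i =
    {p \<in> all_pts A. \<not> snd p i} \<union> (\<Union>\<delta>\<in>{..<fst i}. {p \<in> all_pts A. snd p (\<delta>, snd i)})"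
    by (auto simp: level_def)
  moreover have "\<dots> \<in> additive_class (plank A) 0"
    unfolding plank_def
    by (intro additive_class_Un additive_class_UN coordinate_additive countable_lessThan_omega1)
  ultimately have "level A i \<in> multiplicative_class (plank A) 0"
    unfolding multiplicative_class_iff by (auto simp: level_def)
  then show ?thesis
    using multiplicative_subset_additive[of 0 \<eta> "plank A"] \<open>\<eta> \<noteq> 0\<close>
    by (auto simp: zero_less_iff_omega1)
qed

text \<open>
  The extension of \<open>B\<close> is described through its complement \<open>Q\<close>. Up to \<open>\<gamma>0\<close> each of the countably many
  levels is treated separately with its own set \<open>T i\<close>; beyond \<open>\<gamma>0\<close> the slices no longer change, so
  the set for \<open>\<gamma>0\<close> serves there. In the tail the copy is recognised by whether \<open>x \<in> A\<close>,
  and this condition and its negation are both of additive class \<open>\<alpha> + 1\<close>.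
\<close>

lemma embedded_plank:
  assumes A: "A \<in> additive_class euclidean \<alpha>"
  shows "embedded_of_class (succ \<alpha>) (plank A) (low_pts A)"
proof -
  define \<eta> where "\<eta> = succ \<alpha>"
  have "\<alpha> < \<eta>" unfolding \<eta>_def by (rule less_succ)
  then have \<eta>0: "\<eta> \<noteq> 0" by auto
  have half: "{x. x \<in> A \<longleftrightarrow> b} \<in> additive_class euclidean \<eta>" for b
  proof (cases b)
    case True
    then show ?thesis
      using subsetD[OF additive_class_mono[OF less_imp_le[OF \<open>\<alpha> < \<eta>\<close>]] A] by simp
  next
    case False
    have "UNIV - A \<in> multiplicative_class euclidean \<alpha>"
      using A additive_class_iff_Diff[of A euclidean \<alpha>] by simp
    then have "UNIV - A \<in> additive_class euclidean \<eta>"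
      using multiplicative_subset_additive[OF \<open>\<alpha> < \<eta>\<close>] by blast
    moreover have "{x. x \<in> A \<longleftrightarrow> b} = UNIV - A" using False by auto
    ultimately show ?thesis by simp
  qed
  have fst_additive: "{p \<in> all_pts A. fst p \<in> S} \<in> additive_class (plank A) \<eta>"
    if "S \<in> additive_class euclidean \<eta>" for S
  proof -
    have "continuous_map (plank A) euclidean fst"
      unfolding plank_def by (intro continuous_map_from_subtopology continuous_map_fst_ambient)
    from additive_class_preimage[OF this that] show ?thesis by simp
  qed
  have "\<exists>C \<in> multiplicative_class (plank A) \<eta>. C \<inter> low_pts A = B"
    if B: "B \<in> multiplicative_class (subtopology ambient (low_pts A)) \<eta>" for B
  proof -
    from multiplicative_class_eventually_constant[OF order_refl B]
    obtain \<gamma>0 where eventual: "\<forall>x q q'. pt A x q \<in> low_pts A \<longrightarrow> pt A x q' \<in> low_pts A \<longrightarrow>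
        beyond \<gamma>0 q \<longrightarrow> beyond \<gamma>0 q' \<longrightarrow> (pt A x q \<in> B \<longleftrightarrow> pt A x q' \<in> B)" ..
    have \<gamma>0: "pt A x (Some \<gamma>) \<in> B \<longleftrightarrow> pt A x (Some \<gamma>0) \<in> B" if "\<gamma>0 \<le> \<gamma>" for x \<gamma>
      using eventual[rule_format, of x "Some \<gamma>" "Some \<gamma>0"] that by simp
    have "\<exists>T. T \<in> multiplicative_class euclidean \<eta> \<and>
        (\<forall>x. (x \<in> A \<longleftrightarrow> snd i) \<longrightarrow> (x \<in> T \<longleftrightarrow> pt A x (Some (fst i)) \<in> B))" for i
    proof -
      let ?S = "{x. x \<in> A \<longleftrightarrow> snd i}"
      have "continuous_map (top_of_set ?S) (subtopology ambient (low_pts A)) (\<lambda>x. pt A x (Some (fst i)))"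
        using continuous_map_pt_slice by (simp add: continuous_map_in_subtopology)
      from multiplicative_class_preimage[OF this B]
      have "{x \<in> ?S. pt A x (Some (fst i)) \<in> B} \<in> multiplicative_class (top_of_set ?S) \<eta>" by simp
      from multiplicative_class_trace[OF this] obtain T where
        "T \<in> multiplicative_class euclidean \<eta>" "{x \<in> ?S. pt A x (Some (fst i)) \<in> B} = ?S \<inter> T" ..
      moreover from this(2) have "x \<in> T \<longleftrightarrow> pt A x (Some (fst i)) \<in> B" if "x \<in> ?S" for x
        using that by (metis (no_types, lifting) IntD2 IntI mem_Collect_eq)
      ultimately show ?thesis by auto
    qed
    then have "\<forall>i. \<exists>T. T \<in> multiplicative_class euclidean \<eta> \<and>
        (\<forall>x. (x \<in> A \<longleftrightarrow> snd i) \<longrightarrow> (x \<in> T \<longleftrightarrow> pt A x (Some (fst i)) \<in> B))" by (intro allI)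
    from choice[OF this] obtain T where
      T: "\<And>i. T i \<in> multiplicative_class euclidean \<eta>"
      "\<And>x \<gamma>. x \<in> T (\<gamma>, x \<in> A) \<longleftrightarrow> pt A x (Some \<gamma>) \<in> B" by auto
    define Q where "Q =
      (\<Union>i\<in>{..\<gamma>0} \<times> UNIV. {p \<in> all_pts A. fst p \<in> UNIV - T i} \<inter> level A i) \<union>
      (\<Union>b. {p \<in> all_pts A. fst p \<in> {x. x \<in> A \<longleftrightarrow> b}} \<inter> {p \<in> all_pts A. fst p \<in> UNIV - T (\<gamma>0, b)} \<inter>
        {p \<in> all_pts A. \<not> snd p (\<gamma>0, b)})"
    have "{..\<gamma>0} = insert \<gamma>0 {..<\<gamma>0}" by auto
    then have "countable {..\<gamma>0}" using countable_lessThan_omega1[of \<gamma>0] by simp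
    moreover have "UNIV - T i \<in> additive_class euclidean \<eta>" for i
      using T(1)[of i] by (simp add: multiplicative_class_iff)
    ultimately have "Q \<in> additive_class (plank A) \<eta>"
      unfolding Q_def
      by (intro additive_class_Un additive_class_UN additive_class_Int \<eta>0 fst_additive level_additive half
          countable_SIGMA countable_finite[OF finite] coordinate_additive[where M = "all_pts A", folded plank_def]) auto
    then have "all_pts A - Q \<in> multiplicative_class (plank A) \<eta>"
      by (simp add: multiplicative_class_def)
    moreover have "(all_pts A - Q) \<inter> low_pts A = B"
    proof -
      have inQ: "pt A x (Some \<gamma>) \<in> Q \<longleftrightarrow> pt A x (Some \<gamma>) \<notin> B" for x \<gamma>
      proof (cases "\<gamma> \<le> \<gamma>0")
        case True
        then have "pt A x (Some \<gamma>) \<in> Q \<longleftrightarrow> x \<notin> T (\<gamma>, x \<in> A)"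
          unfolding Q_def by (auto simp: pt_in_level snd_pt)
        then show ?thesis using T(2) by simp
      next
        case False
        then have "pt A x (Some \<gamma>) \<in> Q \<longleftrightarrow> x \<notin> T (\<gamma>0, x \<in> A)"
          unfolding Q_def by (auto simp: pt_in_level snd_pt)
        then show ?thesis using T(2) \<gamma>0[of \<gamma> x] False by simp
      qed
      have "B \<subseteq> low_pts A" using multiplicative_class_subset[OF B] by simp
      moreover have "p \<in> Q \<longleftrightarrow> p \<notin> B" if "p \<in> low_pts A" for p
      proof -
        obtain x \<gamma> where p: "p = pt A x (Some \<gamma>)" using \<open>p \<in> low_pts A\<close> by (rule low_ptsE)
        show ?thesis unfolding p by (rule inQ)
      qed
      ultimately show ?thesis
        using low_subset_all[of A] by auto
    qed
    ultimately show ?thesis by (rule bexI[rotated])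
  qed
  then show ?thesis
    unfolding embedded_of_class_iff subtopology_plank \<eta>_def using low_subset_all by simp
qed

text \<open>
  The exponential function keeps the images of ordinals away from 0, the image of \<open>\<infinity>\<close>.
\<close>

lemma ex_inj_points_to_plane: "\<exists>h :: point \<Rightarrow> real \<times> real. inj_on h (all_pts A)"
proof -
  obtain j :: "(nat \<Rightarrow> real) \<Rightarrow> real" where j: "inj j" using ex_inj_sequences_to_real ..
  obtain r :: "omega1 \<Rightarrow> real" where r: "inj r" using ex_inj_omega1_to_real ..
  define k where "k q = (case q of None \<Rightarrow> 0 | Some \<gamma> \<Rightarrow> exp (r \<gamma>))" for q
  have "inj k"
    by (rule injI) (auto simp: k_def inj_eq[OF r] split: option.splits)
  then have "inj (map_prod j k)" using j by (rule prod.inj_map[rotated])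
  moreover have "inj_on (inv (\<lambda>(x, q). pt A x q)) (all_pts A)"
    unfolding all_pts_def by (rule inj_on_inv_into) simp
  ultimately have "inj_on (map_prod j k \<circ> inv (\<lambda>(x, q). pt A x q)) (all_pts A)"
    by (intro comp_inj_on) (auto intro: inj_on_subset)
  then show ?thesis by blast
qed

theorem theorem5p1:
  fixes \<alpha> :: omega1
  shows "\<exists>(X :: (real \<times> real) topology) E.
    completely_regular_space X \<and> Hausdorff_space X \<and> E \<subseteq> topspace X \<and>
    embedded_of_class (succ \<alpha>) X E \<and> \<not> embedded_of_class \<alpha> X E"
proof -
  from ex_additive_not_multiplicative[of \<alpha>] obtain A :: "(nat \<Rightarrow> real) set" where
    A: "A \<in> additive_class euclidean \<alpha>" "A \<notin> multiplicative_class euclidean \<alpha>"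
    by (elim exE conjE)
  from ex_inj_points_to_plane[of A] obtain h :: "point \<Rightarrow> real \<times> real" where
    "inj_on h (all_pts A)" ..
  then have "inj_on h (topspace (plank A))" by simp
  from ex_homeomorphic_copy[OF this] obtain X g where hom: "homeomorphic_maps (plank A) X h g"
    by (elim exE)
  then have hom': "homeomorphic_maps X (plank A) g h" by (subst homeomorphic_maps_sym)
  have XP: "X homeomorphic_space plank A"
    using hom' unfolding homeomorphic_space_def by (intro exI)
  have gh: "g (h p) = p" if "p \<in> low_pts A" for p
    using hom that low_subset_all[of A] by (auto simp: homeomorphic_maps_def)
  have emb: "embedded_of_class (succ \<alpha>) X (h ` low_pts A)"
    by (rule embedded_of_class_homeomorphic[OF hom embedded_plank[OF A(1)]])
  have "\<not> embedded_of_class \<alpha> X (h ` low_pts A)"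
  proof
    assume "embedded_of_class \<alpha> X (h ` low_pts A)"
    from embedded_of_class_homeomorphic[OF hom' this]
    have "embedded_of_class \<alpha> (plank A) (g ` h ` low_pts A)" .
    moreover have "g ` h ` low_pts A = low_pts A" using gh by (auto simp: image_image)
    ultimately show False using not_embedded_plank[OF A(2)] by simp
  qed
  moreover have "completely_regular_space X" "Hausdorff_space X"
    using homeomorphic_completely_regular_space[OF XP] homeomorphic_Hausdorff_space[OF XP]
      completely_regular_plank[of A] Hausdorff_plank[of A] by simp_all
  moreover have "h ` low_pts A \<subseteq> topspace X"
    using emb unfolding embedded_of_class_def by (rule conjunct1)
  ultimately show ?thesis using emb by (intro exI[of _ X] exI[of _ "h ` low_pts A"] conjI)
qed

end
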